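(* Let $K$ be a field with $\mathrm{char}(K)=0$, let $S=K[t_1,\ldots,t_s]$, and let $L\subset S$ be an arbitrary lattice ideal of height $r$. If $\mathrm{rad}(L)=\mathrm{rad}(g_1,\ldots,g_r)$ for some binomials $g_1,\ldots,g_r$ in $S$, then $L=(g_1,\ldots,g_r)$.
   Context: $\mathbb{N}$ denotes the nonnegative integers; for $a=(a_1,\ldots,a_s)\in\mathbb{N}^s$, $t^a=t_1^{a_1}\cdots t_s^{a_s}$. A binomial is a polynomial of the form $t^a-t^b$ with $a,b\in\mathbb{N}^s$. Any $c\in\mathbb{Z}^s$ is written uniquely as $c=c^+-c^-$ with $c^+,c^-\in\mathbb{N}^s$ having disjoint supports. A lattice ideal is an ideal of the form $I(\mathcal{L})=(\{t^{a^+}-t^{a^-}\mid a\in\mathcal{L}\})\subset S$, where $\mathcal{L}$ is a subgroup of $\mathbb{Z}^s$ (no homogeneity is assumed). $\mathrm{rad}$ denotes the radical of an ideal. *)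

theory Defs
  imports
    "HOL-Algebra.Ideal"
    "HOL-Algebra.Free_Abelian_Groups"
    "HOL-Library.Extended_Nat"
begin

section \<open>Radical and height of an ideal\<close>

definition radical :: "('a, 'b) ring_scheme \<Rightarrow> 'a set \<Rightarrow> 'a set" where
  "radical R I = {x \<in> carrier R. \<exists>n::nat. 0 < n \<and> x [^]\<^bsub>R\<^esub> n \<in> I}"

text \<open>The height of a prime ideal \<open>P\<close> is the supremum of the lengths \<open>n\<close> of the strict chains
  \<open>C 0 \<subset> C 1 \<subset> \<dots> \<subset> C n = P\<close> of prime ideals, and the height of an ideal is the infimum of the
  heights of the primes containing it (\<open>\<infinity>\<close> if there are none).\<close>

definition prime_height :: "('a, 'b) ring_scheme \<Rightarrow> 'a set \<Rightarrow> enat" where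
  "prime_height R P =
     (SUP n \<in> {n. \<exists>C. (\<forall>i\<le>n. primeideal (C i) R) \<and> (\<forall>i<n. C i \<subset> C (Suc i)) \<and> C n = P}. enat n)"

definition height :: "('a, 'b) ring_scheme \<Rightarrow> 'a set \<Rightarrow> enat" where
  "height R I = (INF P \<in> {P. primeideal P R \<and> I \<subseteq> P}. prime_height R P)"

section \<open>The polynomial ring in finitely many variables\<close>

text \<open>A polynomial maps exponent vectors to coefficients; the variables \<open>t\<^sub>1, \<dots>, t\<^sub>s\<close> are numbered
  \<open>0, \<dots>, s - 1\<close>. The operations of \<^theory>\<open>HOL-Library.Poly_Mapping\<close> are the pointwise sum and the
  convolution product, so the ring below is the subring of the polynomials in the first \<open>s\<close>
  variables.\<close>

type_synonym 'k mpoly = "(nat \<Rightarrow>\<^sub>0 nat) \<Rightarrow>\<^sub>0 'k"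

definition exponents :: "nat \<Rightarrow> (nat \<Rightarrow>\<^sub>0 nat) set" where
  "exponents s = {a. Poly_Mapping.keys a \<subseteq> {..<s}}"

definition poly_ring :: "nat \<Rightarrow> 'k::field mpoly ring" where
  "poly_ring s =
     \<lparr>carrier = {p. Poly_Mapping.keys p \<subseteq> exponents s},
      monoid.mult = (*), one = 1, ring.zero = 0, add = (+)\<rparr>"

lemma poly_ring_simps [simp]:
  "carrier (poly_ring s) = {p. Poly_Mapping.keys p \<subseteq> exponents s}"
  "x \<otimes>\<^bsub>poly_ring s\<^esub> y = x * y" "\<one>\<^bsub>poly_ring s\<^esub> = 1"
  "\<zero>\<^bsub>poly_ring s\<^esub> = 0" "x \<oplus>\<^bsub>poly_ring s\<^esub> y = x + y"
  by (simp_all add: poly_ring_def)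

lemma cring_poly_ring: "cring (poly_ring s :: 'k::field mpoly ring)"
proof (rule cringI)
  have add: "a + b \<in> exponents s" if "a \<in> exponents s" "b \<in> exponents s" for a b
    using that Poly_Mapping.keys_add[of a b] by (auto simp: exponents_def)
  show "abelian_group (poly_ring s :: 'k mpoly ring)"
  proof (rule abelian_groupI)
    fix x y :: "'k mpoly"
    assume "x \<in> carrier (poly_ring s)" "y \<in> carrier (poly_ring s)"
    then show "x \<oplus>\<^bsub>poly_ring s\<^esub> y \<in> carrier (poly_ring s)"
      using Poly_Mapping.keys_add[of x y] by auto
  next
    fix x :: "'k mpoly"
    assume "x \<in> carrier (poly_ring s)"
    then show "\<exists>y\<in>carrier (poly_ring s). y \<oplus>\<^bsub>poly_ring s\<^esub> x = \<zero>\<^bsub>poly_ring s\<^esub>"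
      by (intro bexI[of _ "- x"]) auto
  qed (auto simp: algebra_simps)
  show "comm_monoid (poly_ring s :: 'k mpoly ring)"
  proof (rule comm_monoidI)
    fix x y :: "'k mpoly"
    assume "x \<in> carrier (poly_ring s)" "y \<in> carrier (poly_ring s)"
    then show "x \<otimes>\<^bsub>poly_ring s\<^esub> y \<in> carrier (poly_ring s)"
      using Poly_Mapping.keys_mult[of x y] add by fastforce
  qed (auto simp: algebra_simps exponents_def)
qed (simp add: algebra_simps)

definition monomial :: "(nat \<Rightarrow>\<^sub>0 nat) \<Rightarrow> 'k::field mpoly" where
  "monomial a = Poly_Mapping.single a 1"

definition is_binomial :: "nat \<Rightarrow> 'k::field mpoly \<Rightarrow> bool" where
  "is_binomial s g \<longleftrightarrow> (\<exists>a\<in>exponents s. \<exists>b\<in>exponents s. g = monomial a - monomial b)"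

section \<open>Lattice ideals\<close>

definition pos_part :: "(nat \<Rightarrow>\<^sub>0 int) \<Rightarrow> (nat \<Rightarrow>\<^sub>0 nat)" where
  "pos_part a = Poly_Mapping.map nat a"

definition neg_part :: "(nat \<Rightarrow>\<^sub>0 int) \<Rightarrow> (nat \<Rightarrow>\<^sub>0 nat)" where
  "neg_part a = Poly_Mapping.map nat (- a)"

lemma lookup_pos_part: "Poly_Mapping.lookup (pos_part a) i = nat (Poly_Mapping.lookup a i)"
  by (simp add: pos_part_def Poly_Mapping.map.rep_eq when_def)

lemma lookup_neg_part: "Poly_Mapping.lookup (neg_part a) i = nat (- Poly_Mapping.lookup a i)"
  by (simp add: neg_part_def Poly_Mapping.map.rep_eq when_def)

definition lattice_ideal_of :: "nat \<Rightarrow> (nat \<Rightarrow>\<^sub>0 int) set \<Rightarrow> 'k::field mpoly set" where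
  "lattice_ideal_of s \<Lambda> =
     Idl\<^bsub>poly_ring s\<^esub> {monomial (pos_part a) - monomial (neg_part a) | a. a \<in> \<Lambda>}"

text \<open>The free abelian group on \<open>{..<s}\<close> is the group of integer vectors supported in \<open>{..<s}\<close>
  under addition, that is, \<open>\<int>\<^sup>s\<close>.\<close>

definition is_lattice_ideal :: "nat \<Rightarrow> 'k::field mpoly set \<Rightarrow> bool" where
  "is_lattice_ideal s L \<longleftrightarrow>
     (\<exists>\<Lambda>. subgroup \<Lambda> (free_Abelian_group {..<s}) \<and> L = lattice_ideal_of s \<Lambda>)"

end

theory Submission
  imports Defs
begin

text \<open>
  Write \<open>g\<^sub>i = t\<^bsup>a\<^sub>i\<^esup> - t\<^bsup>b\<^sub>i\<^esup>\<close>, \<open>c\<^sub>i = a\<^sub>i - b\<^sub>i\<close> and \<open>I = (g\<^sub>1, \<dots>, g\<^sub>r)\<close>. In characteristic \<open>0\<close> a lattice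
  ideal contains every difference of monomials that is nilpotent modulo it, so equality of the
  radicals makes the lattice \<open>\<Lambda>\<close> of \<open>L\<close> the span of the \<open>c\<^sub>i\<close>; and the height of \<open>L\<close> is at most the rank
  of \<open>\<Lambda>\<close> (counting monomials along a chain of primes), so the \<open>c\<^sub>i\<close> are independent.

  Instead of an unmixedness theorem, the conclusion uses a combinatorial consequence of the radical
  equality. Call the pairs \<open>(a\<^sub>i, b\<^sub>i)\<close> rows. If a nonempty set \<open>Z\<close> of variables is such that \<open>a\<^sub>i\<close> meets
  \<open>Z\<close> iff \<open>b\<^sub>i\<close> does, then fewer than \<open>|Z|\<close> rows meet \<open>Z\<close>. Indeed, otherwise some nontrivial integer
  combination \<open>x\<close> of the \<open>c\<^sub>i\<close> of these rows is nonnegative on \<open>Z\<close>. The moves \<open>a\<^sub>i \<leftrightarrow> b\<^sub>i\<close> that change a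
  multiple of \<open>x\<^sup>-\<close>, which avoids \<open>Z\<close>, all avoid \<open>Z\<close>, so a multiple of \<open>x\<close> is also a combination of
  the other \<open>c\<^sub>i\<close>, contradicting independence.

  Now let \<open>x - y = \<Sum> n\<^sub>i c\<^sub>i\<close>. If none of the moves that remain to be done can be applied to
  \<open>x\<close>, then each of them lacks a coordinate that another one has to provide, and a cycle of such
  moves yields a set \<open>Z\<close> that violates the bound. So the moves can be done in some order, which means
  \<open>t\<^sup>x - t\<^sup>y \<in> I\<close>. Variables that are invertible modulo \<open>I\<close> never block a move.
\<close>

section \<open>Congruences of exponent vectors and their ideals\<close>

lemma poly_mapping_add_induct [case_names single add]:
  assumes single: "\<And>a b. P (Poly_Mapping.single a b)"
    and add: "\<And>p q. P p \<Longrightarrow> P q \<Longrightarrow> P (p + q)"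
  shows "P (p :: 'a \<Rightarrow>\<^sub>0 'b::comm_monoid_add)"
proof (induction p rule: update_induct)
  case const
  then show ?case using single[of _ 0] by simp
next
  case (update f a b)
  then have "Poly_Mapping.update a b f = f + Poly_Mapping.single a b"
    by (intro poly_mapping_eqI)
      (auto simp: lookup_update lookup_add lookup_single in_keys_iff when_def)
  with update single add show ?case by simp
qed

text \<open>It serves both for linear functionals with values in the field and for the map to
  Laurent polynomials behind \<open>toric_ideal\<close>.\<close>

definition psum :: "('a \<Rightarrow> 'b \<Rightarrow> 'c) \<Rightarrow> ('a \<Rightarrow>\<^sub>0 'b::zero) \<Rightarrow> 'c::comm_monoid_add" where
  "psum F p = (\<Sum>u\<in>Poly_Mapping.keys p. F u (Poly_Mapping.lookup p u))"

lemma psum_superset: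
  assumes "finite A" "Poly_Mapping.keys p \<subseteq> A" "\<And>u. F u 0 = 0"
  shows "psum F p = (\<Sum>u\<in>A. F u (Poly_Mapping.lookup p u))"
  unfolding psum_def using assms by (intro sum.mono_neutral_left) (auto simp: in_keys_iff)

lemma psum_add:
  assumes "\<And>u. F u 0 = 0" "\<And>u x y. F u (x + y) = F u x + F u y"
  shows "psum F (p + q) = psum F p + psum F q"
proof -
  let ?A = "Poly_Mapping.keys p \<union> Poly_Mapping.keys q"
  have "psum F r = (\<Sum>u\<in>?A. F u (Poly_Mapping.lookup r u))" if "Poly_Mapping.keys r \<subseteq> ?A" for r
    using that assms(1) by (intro psum_superset) auto
  from this[of p] this[of q] this[of "p + q"] show ?thesis
    using Poly_Mapping.keys_add[of p q] assms(2) by (simp add: lookup_add sum.distrib)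
qed

lemma psum_single:
  assumes "F u 0 = 0"
  shows "psum F (Poly_Mapping.single u c) = F u c"
  using assms by (simp add: psum_def)

abbreviation functional :: "('a \<Rightarrow> 'k) \<Rightarrow> ('a \<Rightarrow>\<^sub>0 'k) \<Rightarrow> 'k::field" where
  "functional h \<equiv> psum (\<lambda>u c. c * h u)"

text \<open>For a congruence \<open>E\<close> this is membership in the ideal generated by the \<open>t\<^sup>u - t\<^sup>v\<close> with
  \<open>E u v\<close>.\<close>

definition class_vanishing :: "('a \<Rightarrow> 'a \<Rightarrow> bool) \<Rightarrow> ('a \<Rightarrow>\<^sub>0 'k::field) \<Rightarrow> bool" where
  "class_vanishing E p \<longleftrightarrow>
     (\<forall>h. (\<forall>u v. E u v \<longrightarrow> h u = h v) \<longrightarrow> functional h p = 0)"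

lemma functional_add: "functional h (p + q) = functional h p + functional h q"
  by (rule psum_add) (auto simp: algebra_simps)

lemma functional_zero [simp]: "functional h 0 = 0"
  by (simp add: psum_def)

lemma functional_uminus: "functional h (- p) = - functional h p"
  using functional_add[of h p "- p"] by (simp add: eq_neg_iff_add_eq_0 add.commute)

lemma functional_single [simp]: "functional h (Poly_Mapping.single u c) = c * h u"
  by (simp add: psum_single)

lemma functional_mult_single:
  "functional h (Poly_Mapping.single v c * p) = c * functional (\<lambda>u. h (v + u)) p"
  by (induction p rule: poly_mapping_add_induct)
    (simp_all add: mult_single functional_add ring_distribs)

lemma functional_sum: "functional h (sum f A) = (\<Sum>i\<in>A. functional h (f i))"
  by (induction A rule: infinite_finite_induct) (auto simp: functional_add)

lemma functional_monomial_mult: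
  "functional h (monomial v * p) = functional (\<lambda>u. h (v + u)) p"
  by (simp add: monomial_def functional_mult_single)

lemma monomial_add: "monomial (a + b) = monomial a * monomial b"
  by (simp add: monomial_def mult_single)

lemma monomial_zero [simp]: "monomial 0 = 1"
  by (simp add: monomial_def)

locale monoid_cong =
  fixes E :: "(nat \<Rightarrow>\<^sub>0 nat) \<Rightarrow> (nat \<Rightarrow>\<^sub>0 nat) \<Rightarrow> bool"
  assumes equiv: "equivp E" and cong_add: "E u v \<Longrightarrow> E (u + w) (v + w)"
begin

lemma refl: "E u u" and sym: "E u v \<Longrightarrow> E v u" and trans: "E u v \<Longrightarrow> E v w \<Longrightarrow> E u w"
  using equiv by (auto dest: equivp_reflp equivp_symp intro: equivp_transp)

lemma cong_add_left: "E u v \<Longrightarrow> E (w + u) (w + v)"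
  using cong_add[of u v w] by (simp add: add.commute)

end

lemma class_vanishing_zero: "class_vanishing E 0"
  by (simp add: class_vanishing_def)

lemma class_vanishing_add:
  "class_vanishing E p \<Longrightarrow> class_vanishing E q \<Longrightarrow> class_vanishing E (p + q)"
  by (simp add: class_vanishing_def functional_add)

lemma class_vanishing_uminus: "class_vanishing E p \<Longrightarrow> class_vanishing E (- p)"
  by (simp add: class_vanishing_def functional_uminus)

lemma class_vanishing_diff:
  "class_vanishing E p \<Longrightarrow> class_vanishing E q \<Longrightarrow> class_vanishing E (p - q)"
  using class_vanishing_add[of E p "- q"] class_vanishing_uminus[of E q] by simp

context monoid_cong
begin

text \<open>Multiplication by a term turns the functional of \<open>h\<close> into a multiple of
  that of the shifted function \<open>\<lambda>u. h (v + u)\<close>, which is again constant on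
  classes because \<open>E\<close> is compatible with addition.\<close>

lemma class_vanishing_mult:
  fixes p q :: "'k::field mpoly"
  assumes "class_vanishing E p"
  shows "class_vanishing E (q * p)"
proof (induction q rule: poly_mapping_add_induct)
  case (single v c)
  show ?case
    unfolding class_vanishing_def
  proof (intro allI impI)
    fix h :: "(nat \<Rightarrow>\<^sub>0 nat) \<Rightarrow> 'k"
    assume "\<forall>u v. E u v \<longrightarrow> h u = h v"
    then have "\<forall>u u'. E u u' \<longrightarrow> h (v + u) = h (v + u')"
      using cong_add_left by blast
    then have "functional (\<lambda>u. h (v + u)) p = 0"
      using assms unfolding class_vanishing_def by (elim allE[of _ "\<lambda>u. h (v + u)"]) simp
    then show "functional h (Poly_Mapping.single v c * p) = 0"
      by (simp add: functional_mult_single)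
  qed
qed (simp add: distrib_right class_vanishing_add)

lemma indicator_class_invariant:
  "\<forall>u v. E u v \<longrightarrow> (of_bool (E u b) :: 'k::field) = of_bool (E v b)"
proof (intro allI impI)
  fix u v assume "E u v"
  then have "E u b = E v b" by (blast intro: sym trans)
  then show "(of_bool (E u b) :: 'k::field) = of_bool (E v b)" by simp
qed

text \<open>The functional maps the binomial to \<open>h a - h b\<close>, and the indicator of the
  class of \<open>b\<close> separates \<open>b\<close> from every inequivalent
  \<open>a\<close>.\<close>

lemma class_vanishing_binomial:
  "class_vanishing E (monomial a - monomial b :: 'k::field mpoly) \<longleftrightarrow> E a b"
proof -
  have eq: "functional h (monomial a - monomial b) = h a - h b"
    for h :: "(nat \<Rightarrow>\<^sub>0 nat) \<Rightarrow> 'k"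
    using functional_add[of h "monomial a" "- monomial b"]
    by (simp add: functional_uminus monomial_def)
  show ?thesis
  proof
    assume "class_vanishing E (monomial a - monomial b :: 'k mpoly)"
    then have "(of_bool (E a b) :: 'k) = of_bool (E b b)"
      using indicator_class_invariant[where 'k = 'k, of b] unfolding class_vanishing_def eq
      by (elim allE[of _ "\<lambda>u. of_bool (E u b)"]) simp
    then show "E a b" using refl by (simp split: if_splits)
  qed (simp add: class_vanishing_def eq)
qed

end

definition nmult :: "nat \<Rightarrow> (nat \<Rightarrow>\<^sub>0 nat) \<Rightarrow> (nat \<Rightarrow>\<^sub>0 nat)" where
  "nmult n a = (\<Sum>i<n. a)"

lemma lookup_nmult [simp]: "Poly_Mapping.lookup (nmult n a) i = n * Poly_Mapping.lookup a i"
  unfolding nmult_def lookup_sum by simp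

lemma nmult_add: "nmult (m + n) a = nmult m a + nmult n a"
  by (rule poly_mapping_eqI) (simp add: lookup_add algebra_simps)

lemma nmult_simps [simp]: "nmult 0 a = 0" "nmult (Suc n) a = a + nmult n a"
  by (rule poly_mapping_eqI; simp add: lookup_add)+

lemma monomial_nmult: "monomial (nmult n a) = monomial a ^ n"
  by (induction n) (simp_all add: monomial_add)

context monoid_cong
begin

text \<open>Otherwise the class of \<open>n b\<close> would contribute \<open>\<plusminus> 1\<close> to the binomial expansion.\<close>

lemma power_binomial_class:
  assumes "class_vanishing E ((monomial a - monomial b :: 'k::field mpoly) ^ n)"
  shows "\<exists>k\<in>{1..n}. E (nmult k a + nmult (n - k) b) (nmult n b)"
proof (rule ccontr)
  assume none: "\<not> ?thesis"
  define h :: "(nat \<Rightarrow>\<^sub>0 nat) \<Rightarrow> 'k" where "h u = of_bool (E u (nmult n b))" for u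
  have term_eq: "of_nat (n choose k) * monomial a ^ k * (- monomial b) ^ (n - k) =
      Poly_Mapping.single (nmult k a + nmult (n - k) b) ((- 1) ^ (n - k) * of_nat (n choose k) :: 'k)"
    for k
  proof -
    have "of_nat (n choose k) * monomial a ^ k * (- monomial b) ^ (n - k) =
        ((- 1) ^ (n - k) * of_nat (n choose k)) * (monomial (nmult k a + nmult (n - k) b) :: 'k mpoly)"
      by (subst power_minus) (simp add: monomial_add monomial_nmult)
    also have "(- 1) ^ (n - k) * of_nat (n choose k) =
        Poly_Mapping.single 0 ((- 1) ^ (n - k) * of_nat (n choose k) :: 'k)"
      by (cases "even (n - k)") (simp_all add: single_uminus)
    finally show ?thesis by (simp add: monomial_def mult_single)
  qed
  have "(monomial a - monomial b :: 'k mpoly) ^ n =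
      (\<Sum>k\<le>n. of_nat (n choose k) * monomial a ^ k * (- monomial b) ^ (n - k))"
    using binomial_ring[of "monomial a :: 'k mpoly" "- monomial b" n] by simp
  then have "functional h ((monomial a - monomial b) ^ n) =
      (\<Sum>k\<le>n. (- 1) ^ (n - k) * of_nat (n choose k) * h (nmult k a + nmult (n - k) b))"
    by (simp add: term_eq functional_sum)
  also have "\<dots> = (\<Sum>k\<in>{0}. (- 1) ^ (n - k) * of_nat (n choose k) * h (nmult k a + nmult (n - k) b))"
    using none by (intro sum.mono_neutral_right) (auto simp: h_def)
  also have "\<dots> = (- 1) ^ n"
    by (simp add: h_def refl)
  finally have "functional h ((monomial a - monomial b) ^ n) \<noteq> 0" by simp
  moreover have "\<forall>u v. E u v \<longrightarrow> h u = h v"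
    unfolding h_def by (rule indicator_class_invariant)
  ultimately show False
    using assms unfolding class_vanishing_def by blast
qed

end

locale cancel_monoid_cong = monoid_cong +
  assumes cancel: "E (u + w) (v + w) \<Longrightarrow> E u v"
begin

text \<open>A class function \<open>h\<close> is carried along translation by \<open>w\<close> to a
  class function \<open>h'\<close>. Cancellation ensures \<open>h' (w + u) = h u\<close>, so the
  functional of \<open>h'\<close> on the multiple is that of \<open>h\<close> on
  \<open>p\<close>.\<close>

lemma class_vanishing_cancel:
  fixes p :: "'k::field mpoly"
  assumes "class_vanishing E (monomial w * p)"
  shows "class_vanishing E p"
  unfolding class_vanishing_def
proof (intro allI impI)
  fix h :: "(nat \<Rightarrow>\<^sub>0 nat) \<Rightarrow> 'k"
  assume h: "\<forall>u v. E u v \<longrightarrow> h u = h v"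
  \<comment> \<open>Classes without a representative of the form \<open>w + u\<close> get the value
    0, so that \<open>h'\<close> is a class function on the whole monoid.\<close>
  define h' where "h' v = (if \<exists>u. E (w + u) v then h (SOME u. E (w + u) v) else 0)" for v
  have "h' v = h' v'" if "E v v'" for v v'
  proof -
    have "E (w + u) v = E (w + u) v'" for u
      using that by (blast intro: sym trans)
    then show ?thesis by (simp add: h'_def)
  qed
  then have "functional h' (monomial w * p) = 0"
    using assms unfolding class_vanishing_def by blast
  moreover have "h' (w + u) = h u" for u
  proof -
    have ex: "\<exists>u'. E (w + u') (w + u)" using refl by blast
    then have "E (w + (SOME u'. E (w + u') (w + u))) (w + u)" by (rule someI_ex)
    then have "E (SOME u'. E (w + u') (w + u)) u" using cancel by (simp add: add.commute)
    with ex h show ?thesis by (simp add: h'_def)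
  qed
  ultimately show "functional h p = 0"
    by (simp add: functional_monomial_mult)
qed

text \<open>The quotient monoid algebra has no nilpotent differences of monomials: if \<open>x\<^sup>o = y\<^sup>o\<close>, then
  \<open>x\<^sup>o\<^sup>-\<^sup>1 + \<dots> + y\<^sup>o\<^sup>-\<^sup>1\<close> kills \<open>x - y\<close> and is congruent to the non-zero-divisor \<open>o y\<^sup>o\<^sup>-\<^sup>1\<close> modulo
  \<open>x - y\<close>, which lowers the exponent of a vanishing power of \<open>x - y\<close>.\<close>

lemma power_binomial_reduced:
  assumes "class_vanishing E ((monomial a - monomial b :: 'k::field_char_0 mpoly) ^ n)"
  shows "E a b"
  using assms
proof (induction n)
  case 0
  then show ?case using power_binomial_class[OF "0.prems"] by simp
next
  case (Suc n)
  let ?x = "monomial a :: 'k mpoly" and ?y = "monomial b :: 'k mpoly"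
  obtain k where k: "k \<in> {1..Suc n}" "E (nmult k a + nmult (Suc n - k) b) (nmult (Suc n) b)"
    using power_binomial_class[OF Suc.prems] by blast
  moreover have "nmult (Suc n) b = nmult k b + nmult (Suc n - k) b"
    using k(1) by (subst nmult_add[symmetric]) simp
  ultimately have Ek: "E (nmult k a) (nmult k b)" using cancel by metis
  show ?case
  proof (cases n)
    case 0
    with Suc.prems show ?thesis by (simp add: class_vanishing_binomial)
  next
    case n: (Suc m)
    obtain l where l: "k = Suc l" using k(1) by (cases k) auto
    define N where "N = (\<Sum>p<k. ?x ^ p * ?y ^ (l - p))"
    have xN: "(?x - ?y) * N = ?x ^ k - ?y ^ k"
      unfolding N_def l by (subst diff_power_eq_sum) simp
    have "N - of_nat k * ?y ^ l = (\<Sum>p<k. (?x ^ p - ?y ^ p) * ?y ^ (l - p))"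
    proof -
      have "of_nat k * ?y ^ l = (\<Sum>p<k. ?y ^ p * ?y ^ (l - p))"
        using l by (simp flip: power_add)
      then show ?thesis
        unfolding N_def by (simp only: left_diff_distrib sum_subtractf)
    qed
    moreover have "(?x - ?y) dvd (\<Sum>p<k. (?x ^ p - ?y ^ p) * ?y ^ (l - p))"
    proof (intro dvd_sum dvd_mult2)
      show "(?x - ?y) dvd ?x ^ p - ?y ^ p" for p
        using power_diff_sumr2[of ?x p ?y] by simp
    qed
    ultimately obtain q where q: "N - of_nat k * ?y ^ l = (?x - ?y) * q"
      by (metis dvdE)
    have "class_vanishing E (?x ^ k - ?y ^ k)"
      using class_vanishing_binomial[of "nmult k a" "nmult k b"] Ek
      by (simp add: monomial_nmult)
    \<comment> \<open>Two multiples of vanishing polynomials are subtracted so that the cofactor of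
      \<open>(?x - ?y) ^ n\<close> becomes the single term \<open>of_nat k * ?y ^ l\<close>, which
      can be cancelled.\<close>
    then have "class_vanishing E ((?x - ?y) ^ m * (?x ^ k - ?y ^ k) - q * (?x - ?y) ^ Suc n)"
      by (blast intro: class_vanishing_diff class_vanishing_mult Suc.prems)
    also have "(?x - ?y) ^ m * (?x ^ k - ?y ^ k) - q * (?x - ?y) ^ Suc n =
        (?x - ?y) ^ n * (N - (?x - ?y) * q)"
      by (simp add: n algebra_simps flip: xN)
    also have "N - (?x - ?y) * q = of_nat k * ?y ^ l"
      using q by (simp add: algebra_simps)
    finally have "class_vanishing E (Poly_Mapping.single 0 (1 / of_nat k) *
        ((?x - ?y) ^ n * (of_nat k * ?y ^ l)))"
      by (rule class_vanishing_mult)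
    also have "Poly_Mapping.single 0 (1 / of_nat k) * ((?x - ?y) ^ n * (of_nat k * ?y ^ l)) =
        (Poly_Mapping.single 0 (1 / of_nat k) * of_nat k) * (?y ^ l * (?x - ?y) ^ n)"
      by (simp only: ac_simps)
    \<comment> \<open>Characteristic 0 enters here: \<open>k = Suc l\<close> is invertible as a
      constant.\<close>
    also have "Poly_Mapping.single 0 (1 / of_nat k) * of_nat k = (1 :: 'k mpoly)"
      using l by (simp add: mult_single del: of_nat_Suc flip: single_of_nat)
    finally have "class_vanishing E ((?x - ?y) ^ n)"
      using class_vanishing_cancel[of "nmult l b"] by (simp add: monomial_nmult)
    then show ?thesis by (rule Suc.IH)
  qed
qed

end

section \<open>Height and chains of primes\<close>

lemma minus_one_carrier: "- 1 \<in> carrier (poly_ring s :: 'k::field mpoly ring)"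
  by (simp add: exponents_def)

lemma monomial_carrier: "a \<in> exponents s \<Longrightarrow> monomial a \<in> carrier (poly_ring s)"
  by (simp add: monomial_def)

lemma nat_pow_poly_ring [simp]: "x [^]\<^bsub>poly_ring s\<^esub> (n::nat) = x ^ n"
proof -
  interpret cring "poly_ring s" by (rule cring_poly_ring)
  show ?thesis by (induction n) (simp_all add: mult.commute)
qed

lemma exponents_add: "a \<in> exponents s \<Longrightarrow> b \<in> exponents s \<Longrightarrow> a + b \<in> exponents s"
  using Poly_Mapping.keys_add[of a b] by (auto simp: exponents_def)

context
  fixes I :: "'k::field mpoly set" and s
  assumes I: "ideal I (poly_ring s)"
begin

interpretation ideal I "poly_ring s" by (rule I)

lemma poly_ideal_carrier: "p \<in> I \<Longrightarrow> p \<in> carrier (poly_ring s)"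
  by (rule Icarr)

lemma poly_ideal_zero: "0 \<in> I"
  using additive_subgroup.zero_closed[OF is_additive_subgroup] by simp

lemma poly_ideal_add: "p \<in> I \<Longrightarrow> q \<in> I \<Longrightarrow> p + q \<in> I"
  using additive_subgroup.a_closed[OF is_additive_subgroup, of p q] by simp

lemma poly_ideal_mult: "p \<in> I \<Longrightarrow> q \<in> carrier (poly_ring s) \<Longrightarrow> q * p \<in> I"
  using I_l_closed[of p q] by simp

lemma poly_ideal_uminus: "p \<in> I \<Longrightarrow> - p \<in> I"
  using poly_ideal_mult[OF _ minus_one_carrier, of p] by simp

lemma poly_ideal_diff: "p \<in> I \<Longrightarrow> q \<in> I \<Longrightarrow> p - q \<in> I"
  using poly_ideal_add[OF _ poly_ideal_uminus, of p q] by simp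

end

lemma poly_idealI:
  fixes I :: "'k::field mpoly set"
  assumes carrier: "I \<subseteq> carrier (poly_ring s)"
    and zero: "0 \<in> I"
    and add: "\<And>p q. p \<in> I \<Longrightarrow> q \<in> I \<Longrightarrow> p + q \<in> I"
    and mult: "\<And>p q. p \<in> I \<Longrightarrow> q \<in> carrier (poly_ring s) \<Longrightarrow> q * p \<in> I"
  shows "ideal I (poly_ring s)"
proof -
  interpret R: cring "poly_ring s :: 'k mpoly ring" by (rule cring_poly_ring)
  show ?thesis
  proof (rule idealI)
    show "subgroup I (add_monoid (poly_ring s))"
    proof (rule R.add.subgroupI)
      fix p assume p: "p \<in> I"
      have "\<ominus>\<^bsub>poly_ring s\<^esub> p = - p"
        using p carrier by (intro R.sum_zero_eq_neg[symmetric]) auto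
      with mult[OF p minus_one_carrier] show "\<ominus>\<^bsub>poly_ring s\<^esub> p \<in> I" by simp
    qed (use carrier zero add in auto)
  qed (use mult R.ring_axioms in \<open>auto simp: mult.commute\<close>)
qed

lemma genideal_subset:
  assumes "ideal I (poly_ring s)" "S \<subseteq> I"
  shows "Idl\<^bsub>poly_ring s\<^esub> S \<subseteq> I"
  using assms unfolding genideal_def by blast

lemma radical_superset:
  assumes "ideal I (poly_ring s)"
  shows "I \<subseteq> radical (poly_ring s) I"
  using poly_ideal_carrier[OF assms] unfolding radical_def
  by (auto intro!: exI[of _ "1::nat"])

lemma primeideal_poly_ring_mult:
  assumes "primeideal C (poly_ring s :: 'k::field mpoly ring)"
    "p \<in> carrier (poly_ring s)" "q \<in> carrier (poly_ring s)" "p * q \<in> C"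
  shows "p \<in> C \<or> q \<in> C"
  using primeideal.I_prime[OF assms(1-3)] assms(4) by simp

text \<open>Elimination without division: an equation with a nonzero coefficient at \<open>j\<close>
  removes that unknown from the others by cross-multiplication. It is applied over a field to count
  monomials and over the integers to combine lattice vectors.\<close>

lemma finite_system_nontrivial_solution:
  fixes q :: "'e \<Rightarrow> 'i \<Rightarrow> 'a::idom"
  assumes "finite S" "finite I" "card S < card I"
  shows "\<exists>x. (\<exists>i\<in>I. x i \<noteq> 0) \<and> (\<forall>e\<in>S. (\<Sum>i\<in>I. q e i * x i) = 0)"
  using assms
proof (induction S arbitrary: I q rule: finite_induct)
  case empty
  then have "I \<noteq> {}" by auto
  then show ?case by (auto intro!: exI[of _ "\<lambda>_. 1"])
next
  case (insert e S)
  show ?case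
  proof (cases "\<forall>i\<in>I. q e i = 0")
    case True
    have "card S < card I" using insert by simp
    with insert obtain x where "\<exists>i\<in>I. x i \<noteq> 0" "\<forall>e\<in>S. (\<Sum>i\<in>I. q e i * x i) = 0"
      by blast
    with True show ?thesis by (intro exI[of _ x]) auto
  next
    case False
    then obtain j where j: "j \<in> I" "q e j \<noteq> 0" by blast
    let ?I = "I - {j}"
    define q' where "q' d i = q e j * q d i - q d j * q e i" for d i
    have "card S < card ?I" using insert j by simp
    then obtain x where x: "\<exists>i\<in>?I. x i \<noteq> 0" "\<And>d. d \<in> S \<Longrightarrow> (\<Sum>i\<in>?I. q' d i * x i) = 0"
      using insert.IH[of ?I q'] insert.prems by auto
    \<comment> \<open>Scaling the smaller solution by the pivot \<open>q e j\<close> makes the value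
      required at \<open>j\<close> an element of the ring.\<close>
    define y where "y i = (if i = j then - (\<Sum>i\<in>?I. q e i * x i) else q e j * x i)" for i
    have y: "(\<Sum>i\<in>I. q d i * y i) =
        q e j * (\<Sum>i\<in>?I. q d i * x i) - q d j * (\<Sum>i\<in>?I. q e i * x i)" for d
    proof -
      have "(\<Sum>i\<in>I. q d i * y i) = q d j * y j + (\<Sum>i\<in>?I. q d i * y i)"
        using insert.prems j by (intro sum.remove) auto
      also have "(\<Sum>i\<in>?I. q d i * y i) = q e j * (\<Sum>i\<in>?I. q d i * x i)"
        unfolding sum_distrib_left by (intro sum.cong) (auto simp: y_def algebra_simps)
      finally show ?thesis by (simp add: y_def)
    qed
    have "(\<Sum>i\<in>I. q d i * y i) = 0" if "d \<in> S" for d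
      using x(2)[OF that] unfolding y
      by (simp add: q'_def left_diff_distrib sum_subtractf sum_distrib_left mult.assoc)
    moreover have "(\<Sum>i\<in>I. q e i * y i) = 0"
      by (simp add: y)
    moreover have "\<exists>i\<in>I. y i \<noteq> 0"
      using x(1) j by (auto simp: y_def)
    ultimately show ?thesis by (intro exI[of _ y]) auto
  qed
qed

section \<open>Counting exponent vectors with bounded entries\<close>

text \<open>Bounding each entry separately, rather than the total degree, makes the number of
  exponent vectors an exact power.\<close>

definition box :: "nat set \<Rightarrow> nat \<Rightarrow> (nat \<Rightarrow>\<^sub>0 nat) set" where
  "box J d = {u. Poly_Mapping.keys u \<subseteq> J \<and> (\<forall>i. Poly_Mapping.lookup u i \<le> d)}"

lemma card_box:
  assumes "finite J"
  shows "finite (box J d)" "card (box J d) = (d + 1) ^ card J"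
proof -
  let ?g = "\<lambda>u. restrict (Poly_Mapping.lookup u) J"
  have bij: "bij_betw ?g (box J d) (J \<rightarrow>\<^sub>E {..d})"
    unfolding bij_betw_def
  proof
    show "inj_on ?g (box J d)"
    proof (rule inj_onI, rule poly_mapping_eqI)
      fix u v i assume uv: "u \<in> box J d" "v \<in> box J d" "?g u = ?g v"
      show "Poly_Mapping.lookup u i = Poly_Mapping.lookup v i"
      proof (cases "i \<in> J")
        case True
        with fun_cong[OF uv(3), of i] show ?thesis by simp
      next
        case False
        with uv(1,2) have "i \<notin> Poly_Mapping.keys u" "i \<notin> Poly_Mapping.keys v"
          by (auto simp: box_def)
        then show ?thesis by (simp add: in_keys_iff)
      qed
    qed
    show "?g ` box J d = J \<rightarrow>\<^sub>E {..d}"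
    proof
      show "?g ` box J d \<subseteq> J \<rightarrow>\<^sub>E {..d}" by (auto simp: box_def)
      show "J \<rightarrow>\<^sub>E {..d} \<subseteq> ?g ` box J d"
      proof
        fix h assume h: "h \<in> J \<rightarrow>\<^sub>E {..d}"
        let ?f = "\<lambda>i. if i \<in> J then h i else 0"
        let ?u = "Poly_Mapping.Abs_poly_mapping ?f"
        have "{i. ?f i \<noteq> 0} \<subseteq> J" by auto
        then have lu: "Poly_Mapping.lookup ?u = ?f"
          using assms by (intro lookup_Abs_poly_mapping) (rule finite_subset)
        have "?u \<in> box J d" using h by (auto simp: box_def in_keys_iff lu PiE_def Pi_def split: if_split_asm)
        moreover have "?g ?u = h" using h by (auto simp: lu restrict_def PiE_def extensional_def)
        ultimately show "h \<in> ?g ` box J d" by (intro image_eqI[of _ _ ?u]) simp_all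
      qed
    qed
  qed
  show "finite (box J d)" "card (box J d) = (d + 1) ^ card J"
    using bij_betw_finite[OF bij] bij_betw_same_card[OF bij] assms
    by (simp_all add: finite_PiE card_PiE)
qed

lemma box_mono: "d \<le> e \<Longrightarrow> box J d \<subseteq> box J e"
  unfolding box_def by (auto intro: order_trans)

lemma box_subset_exponents: "box {..<s} d \<subseteq> exponents s"
  by (auto simp: box_def exponents_def)

lemma keys_mult_box:
  fixes p q :: "'k::field mpoly"
  assumes "Poly_Mapping.keys p \<subseteq> box J d" "Poly_Mapping.keys q \<subseteq> box J e"
  shows "Poly_Mapping.keys (p * q) \<subseteq> box J (d + e)"
proof
  fix w assume "w \<in> Poly_Mapping.keys (p * q)"
  then obtain u v where "w = u + v" "u \<in> box J d" "v \<in> box J e"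
    using Poly_Mapping.keys_mult[of p q] assms by blast
  then show "w \<in> box J (d + e)"
    using Poly_Mapping.keys_add[of u v] by (auto simp: box_def lookup_add intro: add_mono)
qed

lemma keys_power_box:
  fixes p :: "'k::field mpoly"
  assumes "Poly_Mapping.keys p \<subseteq> box J d"
  shows "Poly_Mapping.keys (p ^ n) \<subseteq> box J (n * d)"
proof (induction n)
  case 0
  then show ?case by (simp add: box_def)
next
  case (Suc n)
  then show ?case using keys_mult_box[OF assms Suc] by simp
qed

lemma keys_subset_box:
  fixes p :: "'k::field mpoly"
  assumes "p \<in> carrier (poly_ring s)"
  shows "\<exists>d. Poly_Mapping.keys p \<subseteq> box {..<s} d"
proof -
  let ?X = "(\<lambda>(u, i). Poly_Mapping.lookup u i) ` (Poly_Mapping.keys p \<times> {..<s})"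
  have "Poly_Mapping.lookup u i \<le> Max (insert 0 ?X)" if "u \<in> Poly_Mapping.keys p" for u i
  proof (cases "i < s")
    case True
    with that show ?thesis by (intro Max_ge) (auto intro!: image_eqI[of _ _ "(u, i)"])
  next
    case False
    with that assms have "i \<notin> Poly_Mapping.keys u" by (auto simp: exponents_def)
    then show ?thesis by (simp add: in_keys_iff)
  qed
  with assms show ?thesis
    by (intro exI[of _ "Max (insert 0 ?X)"]) (auto simp: box_def exponents_def)
qed

section \<open>Linear independence modulo the primes of a chain\<close>

abbreviation const :: "'k::field \<Rightarrow> 'k mpoly" where
  "const \<equiv> Poly_Mapping.single 0"

lemma const_carrier: "const c \<in> carrier (poly_ring s)"
  by (simp add: exponents_def)

lemma lookup_const_mult [simp]: "Poly_Mapping.lookup (const c * p) u = c * Poly_Mapping.lookup p u"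
  by (simp add: Poly_Mapping.map.rep_eq when_def flip: mult_map_scale_conv_mult)

definition indep_mod :: "'k::field mpoly set \<Rightarrow> 'i set \<Rightarrow> ('i \<Rightarrow> 'k mpoly) \<Rightarrow> bool" where
  "indep_mod P F \<beta> \<longleftrightarrow> (\<forall>c. (\<Sum>i\<in>F. const (c i) * \<beta> i) \<in> P \<longrightarrow> (\<forall>i\<in>F. c i = 0))"

lemma indep_mod_reindex:
  assumes "indep_mod P F \<beta>" "bij_betw g G F"
  shows "indep_mod P G (\<beta> \<circ> g)"
  unfolding indep_mod_def
proof (intro allI impI)
  fix c assume *: "(\<Sum>i\<in>G. const (c i) * (\<beta> \<circ> g) i) \<in> P"
  let ?c = "c \<circ> inv_into G g"
  have inv: "inv_into G g (g i) = i" if "i \<in> G" for i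
    using assms(2) that by (simp add: bij_betw_inv_into_left)
  have "(\<Sum>i\<in>F. const (?c i) * \<beta> i) = (\<Sum>i\<in>G. const (?c (g i)) * \<beta> (g i))"
    by (rule sum.reindex_bij_betw[OF assms(2), symmetric])
  also have "\<dots> = (\<Sum>i\<in>G. const (c i) * (\<beta> \<circ> g) i)"
    by (intro sum.cong) (simp_all add: inv)
  finally have "\<forall>i\<in>F. ?c i = 0"
    using assms(1) * unfolding indep_mod_def by metis
  then show "\<forall>i\<in>G. c i = 0"
    using inv bij_betwE[OF assms(2)] by fastforce
qed

lemma carrier_sum:
  assumes "\<And>i. i \<in> F \<Longrightarrow> f i \<in> carrier (poly_ring s)"
  shows "sum f F \<in> carrier (poly_ring s :: 'k::field mpoly ring)"
proof -
  interpret R: cring "poly_ring s :: 'k mpoly ring" by (rule cring_poly_ring)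
  show ?thesis
    using assms
  proof (induction F rule: infinite_finite_induct)
    case (insert x F)
    then show ?case using R.a_closed[of "f x" "sum f F"] by simp
  qed auto
qed

lemma carrier_mult:
  "p \<in> carrier (poly_ring s) \<Longrightarrow> q \<in> carrier (poly_ring s) \<Longrightarrow>
    p * q \<in> carrier (poly_ring s :: 'k::field mpoly ring)"
  using monoid.m_closed[OF ring.is_monoid[OF cring.axioms(1)[OF cring_poly_ring]], of p s q] by simp

lemma carrier_power:
  "p \<in> carrier (poly_ring s) \<Longrightarrow> p ^ n \<in> carrier (poly_ring s :: 'k::field mpoly ring)"
  using monoid.nat_pow_closed[OF ring.is_monoid[OF cring.axioms(1)[OF cring_poly_ring]], of p s n]
  by simp

text \<open>If \<open>f\<close> lies in the larger ideal only, the constant term of a relation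
  \<open>\<Sum>\<^sub>k f\<^sup>k h\<^sub>k \<in> P\<close> vanishes modulo \<open>Q\<close>, hence is zero, and then \<open>f\<close> can be cancelled modulo \<open>P\<close>.\<close>

lemma indep_mod_powers:
  fixes P Q :: "'k::field mpoly set" and \<beta> :: "'i \<Rightarrow> 'k mpoly"
  assumes P: "primeideal P (poly_ring s)" and Q: "ideal Q (poly_ring s)" and "P \<subseteq> Q"
    and f: "f \<in> Q" "f \<notin> P"
    and \<beta>: "\<And>i. i \<in> F \<Longrightarrow> \<beta> i \<in> carrier (poly_ring s)"
    and indep: "indep_mod Q F \<beta>"
  shows "indep_mod P ({..N} \<times> F) (\<lambda>(k, i). f ^ k * \<beta> i)"
proof -
  define H where "H c k = (\<Sum>i\<in>F. const (c k i) * \<beta> i)" for c :: "nat \<Rightarrow> 'i \<Rightarrow> 'k" and k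
  have H_carrier: "H c k \<in> carrier (poly_ring s)" for c k
    unfolding H_def using \<beta> const_carrier by (intro carrier_sum carrier_mult)
  have f_carrier: "f \<in> carrier (poly_ring s)"
    using poly_ideal_carrier[OF Q f(1)] .
  have indep': "\<forall>i\<in>F. c k i = 0" if "H c k \<in> Q" for c k
    using indep that unfolding indep_mod_def H_def by (elim allE[of _ "c k"]) simp
  have claim: "\<forall>k\<le>N. \<forall>i\<in>F. c k i = 0" if "(\<Sum>k\<le>N. f ^ k * H c k) \<in> P" for c
    using that
  proof (induction N arbitrary: c)
    case 0
    with \<open>P \<subseteq> Q\<close> have "H c 0 \<in> Q" by auto
    from indep'[OF this] show ?case by simp
  next
    case (Suc N)
    define T where "T = (\<Sum>k\<le>N. f ^ k * H (c \<circ> Suc) k)"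
    have T_carrier: "T \<in> carrier (poly_ring s)"
      unfolding T_def by (intro carrier_sum carrier_mult carrier_power f_carrier H_carrier)
    have total: "(\<Sum>k\<le>Suc N. f ^ k * H c k) = H c 0 + T * f"
      unfolding T_def by (subst sum.atMost_Suc_shift)
        (simp add: H_def sum_distrib_left sum_distrib_right mult_ac)
    have "H c 0 + T * f \<in> Q"
      using Suc.prems total \<open>P \<subseteq> Q\<close> by auto
    moreover have "T * f \<in> Q"
      by (rule poly_ideal_mult[OF Q f(1) T_carrier])
    ultimately have "H c 0 \<in> Q"
      using poly_ideal_diff[OF Q, of "H c 0 + T * f" "T * f"] by simp
    then have c0: "\<forall>i\<in>F. c 0 i = 0" by (rule indep')
    then have "H c 0 = 0" by (simp add: H_def)
    with Suc.prems total have "T * f \<in> P" by simp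
    with primeideal_poly_ring_mult[OF P T_carrier f_carrier] f(2) have "T \<in> P" by blast
    then have "\<forall>k\<le>N. \<forall>i\<in>F. (c \<circ> Suc) k i = 0"
      unfolding T_def by (rule Suc.IH)
    note c_Suc = this
    show ?case
    proof (intro allI impI)
      fix k assume "k \<le> Suc N"
      then show "\<forall>i\<in>F. c k i = 0" using c0 c_Suc by (cases k) auto
    qed
  qed
  show ?thesis
    unfolding indep_mod_def
  proof (intro allI impI)
    fix c assume *: "(\<Sum>x\<in>{..N} \<times> F. const (c x) * (case x of (k, i) \<Rightarrow> f ^ k * \<beta> i)) \<in> P"
    have "(\<Sum>x\<in>{..N} \<times> F. const (c x) * (case x of (k, i) \<Rightarrow> f ^ k * \<beta> i)) =
        (\<Sum>k\<le>N. f ^ k * H (\<lambda>k i. c (k, i)) k)"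
      unfolding H_def sum_distrib_left sum.cartesian_product
      by (intro sum.cong) (auto simp: mult_ac)
    with * claim[of "\<lambda>k i. c (k, i)"] show "\<forall>x\<in>{..N} \<times> F. c x = 0" by auto
  qed
qed

text \<open>A larger family would outnumber the monomials of the box and so satisfy a linear
  relation already as polynomials, not only modulo \<open>P\<close>.\<close>

lemma indep_mod_card_le:
  fixes P :: "'k::field mpoly set"
  assumes P: "ideal P (poly_ring s)" and indep: "indep_mod P F \<beta>" and fin: "finite F"
    and \<beta>: "\<And>i. i \<in> F \<Longrightarrow> Poly_Mapping.keys (\<beta> i) \<subseteq> box {..<s} d"
  shows "card F \<le> (d + 1) ^ s"
proof (rule ccontr)
  assume "\<not> ?thesis"
  then have "card (box {..<s} d) < card F" by (simp add: card_box)
  then obtain x where x: "\<exists>i\<in>F. x i \<noteq> 0"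
    "\<And>e. e \<in> box {..<s} d \<Longrightarrow> (\<Sum>i\<in>F. Poly_Mapping.lookup (\<beta> i) e * x i) = 0"
    using finite_system_nontrivial_solution[of "box {..<s} d" F "\<lambda>e i. Poly_Mapping.lookup (\<beta> i) e"]
      fin card_box(1)[of "{..<s}" d] by auto
  have "(\<Sum>i\<in>F. const (x i) * \<beta> i) = 0"
  proof (rule poly_mapping_eqI)
    fix e
    have "(\<Sum>i\<in>F. x i * Poly_Mapping.lookup (\<beta> i) e) = 0"
    proof (cases "e \<in> box {..<s} d")
      case True
      then show ?thesis using x(2) by (simp add: mult.commute)
    next
      case False
      with \<beta> have "Poly_Mapping.lookup (\<beta> i) e = 0" if "i \<in> F" for i
        using that by (meson in_keys_iff subsetD)
      then show ?thesis by simp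
    qed
    then show "Poly_Mapping.lookup (\<Sum>i\<in>F. const (x i) * \<beta> i) e = Poly_Mapping.lookup 0 e"
      by (simp add: lookup_sum)
  qed
  with indep poly_ideal_zero[OF P] have "\<forall>i\<in>F. x i = 0"
    unfolding indep_mod_def by metis
  with x(1) show False by blast
qed

text \<open>Each of the \<open>m\<close> steps down from \<open>C n\<close> multiplies the number of
  independent elements by \<open>N + 1\<close>, through the powers of some \<open>f j\<close> up to
  \<open>N\<close>, and enlarges the box bound by \<open>N * e\<close>.\<close>

lemma indep_mod_prime_chain:
  fixes C :: "nat \<Rightarrow> 'k::field mpoly set" and F :: "nat set"
  assumes prime: "\<And>i. i \<le> n \<Longrightarrow> primeideal (C i) (poly_ring s)"
    and f: "\<And>i. i < n \<Longrightarrow> f i \<in> C (Suc i) - C i" "\<And>i. i < n \<Longrightarrow> C i \<subseteq> C (Suc i)"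
    and f_keys: "\<And>i. i < n \<Longrightarrow> Poly_Mapping.keys (f i) \<subseteq> box {..<s} e"
    and F: "finite F" "indep_mod (C n) F \<beta>"
    and \<beta>: "\<And>i. i \<in> F \<Longrightarrow> Poly_Mapping.keys (\<beta> i) \<subseteq> box {..<s} d"
    and "m \<le> n"
  shows "\<exists>(G::nat set) \<gamma>. finite G \<and> card G = (N + 1) ^ m * card F \<and> indep_mod (C (n - m)) G \<gamma> \<and>
    (\<forall>i\<in>G. Poly_Mapping.keys (\<gamma> i) \<subseteq> box {..<s} (d + m * (N * e)))"
  using \<open>m \<le> n\<close>
proof (induction m)
  case 0
  then show ?case using F \<beta> by auto
next
  case (Suc m)
  define j where "j = n - Suc m"
  have j: "j < n" "n - m = Suc j" using Suc.prems by (auto simp: j_def)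
  from Suc obtain G :: "nat set" and \<gamma> where G: "finite G" "card G = (N + 1) ^ m * card F"
    "indep_mod (C (Suc j)) G \<gamma>"
    "\<And>i. i \<in> G \<Longrightarrow> Poly_Mapping.keys (\<gamma> i) \<subseteq> box {..<s} (d + m * (N * e))"
    unfolding j(2)[symmetric] by auto
  let ?\<delta> = "\<lambda>(k, i). f j ^ k * \<gamma> i"
  have indep: "indep_mod (C j) ({..N} \<times> G) ?\<delta>"
  proof (rule indep_mod_powers[OF _ _ _ _ _ _ G(3)])
    show "\<gamma> i \<in> carrier (poly_ring s)" if "i \<in> G" for i
      using G(4)[OF that] box_subset_exponents by fastforce
    show "ideal (C (Suc j)) (poly_ring s)"
      using prime[of "Suc j"] j(1) by (intro primeideal.axioms(1)) auto
  qed (use prime[of j] f j(1) in auto)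
  have keys: "Poly_Mapping.keys (?\<delta> x) \<subseteq> box {..<s} (d + Suc m * (N * e))" if "x \<in> {..N} \<times> G" for x
  proof -
    obtain k i where x: "x = (k, i)" "k \<le> N" "i \<in> G" using \<open>x \<in> _\<close> by auto
    have "Poly_Mapping.keys (f j ^ k * \<gamma> i) \<subseteq> box {..<s} (k * e + (d + m * (N * e)))"
      using keys_mult_box[OF keys_power_box[OF f_keys[OF j(1)]] G(4)[OF x(3)]] .
    also have "\<dots> \<subseteq> box {..<s} (d + Suc m * (N * e))"
      using x(2) by (intro box_mono) (simp add: mult_right_mono)
    finally show ?thesis by (simp add: x(1))
  qed
  have fin: "finite ({..N} \<times> G)" using G(1) by simp
  \<comment> \<open>Reindexing the pairs by natural numbers keeps the index type fixed throughout
    the induction.\<close>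
  obtain g where g: "bij_betw g {0..<card ({..N} \<times> G)} ({..N} \<times> G)"
    using ex_bij_betw_nat_finite[OF fin] by blast
  show ?case
  proof (intro exI conjI ballI)
    show "indep_mod (C (n - Suc m)) {0..<card ({..N} \<times> G)} (?\<delta> \<circ> g)"
      using indep_mod_reindex[OF indep g] by (simp add: j_def)
    show "card {0..<card ({..N} \<times> G)} = (N + 1) ^ Suc m * card F"
      by (simp add: card_cartesian_product G(2) algebra_simps)
    fix i assume "i \<in> {0..<card ({..N} \<times> G)}"
    then have "g i \<in> {..N} \<times> G" using bij_betwE[OF g] by blast
    from keys[OF this] show "Poly_Mapping.keys ((?\<delta> \<circ> g) i) \<subseteq> box {..<s} (d + Suc m * (N * e))"
      by simp
  qed simp
qed

text \<open>Counting replaces dimension theory: the \<open>(N + 1) ^ card J\<close> monomials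
  independent modulo the top prime yield \<open>(N + 1) ^ (n + card J)\<close> elements independent
  modulo \<open>C 0\<close>, in an \<open>s\<close>-dimensional box whose side grows only linearly
  in \<open>N\<close>. For large \<open>N\<close> this forces
  \<open>n + card J \<le> s\<close>.\<close>

lemma prime_chain_length:
  fixes C :: "nat \<Rightarrow> 'k::field mpoly set"
  assumes prime: "\<And>i. i \<le> n \<Longrightarrow> primeideal (C i) (poly_ring s)"
    and chain: "\<And>i. i < n \<Longrightarrow> C i \<subset> C (Suc i)"
    and J: "J \<subseteq> {..<s}" and indep: "\<And>N. indep_mod (C n) (box J N) monomial"
  shows "card J + n \<le> s"
proof (rule ccontr)
  assume contr: "\<not> ?thesis"
  have subset: "C i \<subseteq> C (Suc i)" if "i < n" for i
    using chain[OF that] by blast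
  have "\<exists>f. \<forall>i<n. f i \<in> C (Suc i) - C i"
    using chain by (intro choice) blast
  then obtain f where f: "\<And>i. i < n \<Longrightarrow> f i \<in> C (Suc i) - C i" by blast
  have "\<exists>d. \<forall>i<n. Poly_Mapping.keys (f i) \<subseteq> box {..<s} (d i)"
  proof (intro choice allI)
    fix i
    show "\<exists>d. i < n \<longrightarrow> Poly_Mapping.keys (f i) \<subseteq> box {..<s} d"
    proof (cases "i < n")
      case True
      then have "f i \<in> carrier (poly_ring s)"
        using f[of i] prime[of "Suc i"] poly_ideal_carrier[OF primeideal.axioms(1)]
        by (metis DiffD1 Suc_leI)
      from keys_subset_box[OF this] show ?thesis by blast
    qed simp
  qed
  then obtain d where d: "\<And>i. i < n \<Longrightarrow> Poly_Mapping.keys (f i) \<subseteq> box {..<s} (d i)" by blast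
  define e where "e = (\<Sum>i<n. d i)"
  have f_keys: "Poly_Mapping.keys (f i) \<subseteq> box {..<s} e" if "i < n" for i
  proof -
    have "d i \<le> e" unfolding e_def using that by (intro member_le_sum) auto
    from box_mono[OF this] d[OF that] show ?thesis by blast
  qed
  \<comment> \<open>\<open>W\<close> bounds the growth of the box, since
    \<open>N + n * (N * e) + 1 \<le> (N + 1) * W\<close>. Taking \<open>N = W ^ s\<close> makes the
    resulting constant factor smaller than \<open>N + 1\<close>.\<close>
  define W where "W = n * e + 1"
  define N where "N = W ^ s"
  have fin: "finite J" using J finite_subset by blast
  obtain g where g: "bij_betw g {0..<card (box J N)} (box J N)"
    using ex_bij_betw_nat_finite[OF card_box(1)[OF fin]] by blast
  have "\<exists>(G::nat set) \<gamma>. finite G \<and> card G = (N + 1) ^ n * card {0..<card (box J N)} \<and>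
      indep_mod (C (n - n)) G \<gamma> \<and>
      (\<forall>i\<in>G. Poly_Mapping.keys (\<gamma> i) \<subseteq> box {..<s} (N + n * (N * e)))"
  proof (rule indep_mod_prime_chain[where C = C and f = f and e = e and m = n])
    show "indep_mod (C n) {0..<card (box J N)} (monomial \<circ> g)"
      by (rule indep_mod_reindex[OF indep g])
    fix i assume "i \<in> {0..<card (box J N)}"
    then have "g i \<in> box J N" using bij_betwE[OF g] by blast
    then show "Poly_Mapping.keys ((monomial \<circ> g) i :: 'k mpoly) \<subseteq> box {..<s} N"
      using J by (auto simp: monomial_def box_def)
  qed (use prime f f_keys subset in auto)
  then obtain G :: "nat set" and \<gamma> where G: "finite G" "card G = (N + 1) ^ n * card (box J N)"
    "indep_mod (C 0) G \<gamma>" "\<And>i. i \<in> G \<Longrightarrow> Poly_Mapping.keys (\<gamma> i) \<subseteq> box {..<s} (N + n * (N * e))"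
    by auto
  have "card G \<le> (N + n * (N * e) + 1) ^ s"
    using indep_mod_card_le[OF primeideal.axioms(1)[OF prime] G(3,1,4)] by simp
  also have "\<dots> \<le> ((N + 1) * W) ^ s"
    by (intro power_mono) (auto simp: W_def algebra_simps)
  also have "\<dots> = (N + 1) ^ s * N"
    by (simp only: N_def power_mult_distrib)
  finally have "(N + 1) ^ (n + card J) \<le> (N + 1) ^ s * N"
    by (simp add: G(2) card_box(2)[OF fin] power_add)
  moreover have "(N + 1) ^ Suc s \<le> (N + 1) ^ (n + card J)"
    using contr by (intro power_increasing) auto
  ultimately have "(N + 1) ^ Suc s \<le> (N + 1) ^ s * N"
    by (rule order_trans[rotated])
  then show False by (simp add: algebra_simps)
qed

text \<open>The kernel of the ring homomorphism \<open>t\<^sup>u \<mapsto> x\<^bsup>\<phi> u\<^esup>\<close> into the Laurent polynomials.\<close>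

definition toric_ideal :: "nat \<Rightarrow> ((nat \<Rightarrow>\<^sub>0 nat) \<Rightarrow> (nat \<Rightarrow>\<^sub>0 int)) \<Rightarrow> 'k::field mpoly set" where
  "toric_ideal s \<phi> =
     {p \<in> carrier (poly_ring s). psum (\<lambda>u. Poly_Mapping.single (\<phi> u)) p = 0}"

context
  fixes \<phi> :: "(nat \<Rightarrow>\<^sub>0 nat) \<Rightarrow> (nat \<Rightarrow>\<^sub>0 int)"
  assumes \<phi>_add: "\<And>u v. \<phi> (u + v) = \<phi> u + \<phi> v"
begin

private abbreviation \<Phi> :: "'k::field mpoly \<Rightarrow> (nat \<Rightarrow>\<^sub>0 int) \<Rightarrow>\<^sub>0 'k" where
  "\<Phi> \<equiv> psum (\<lambda>u. Poly_Mapping.single (\<phi> u))"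

lemma exponent_map_zero: "\<phi> 0 = 0"
  using \<phi>_add[of 0 0] by simp

lemma toric_map_add: "\<Phi> (p + q) = \<Phi> p + \<Phi> q"
  by (rule psum_add) (simp_all add: single_add)

lemma toric_map_single: "\<Phi> (Poly_Mapping.single u c) = Poly_Mapping.single (\<phi> u) c"
  by (simp add: psum_single)

lemma toric_map_sum: "\<Phi> (sum f A) = (\<Sum>i\<in>A. \<Phi> (f i))"
  by (induction A rule: infinite_finite_induct) (simp_all add: toric_map_add, simp_all add: psum_def)

lemma toric_map_mult: "\<Phi> (p * q) = \<Phi> p * \<Phi> q"
proof (induction p rule: poly_mapping_add_induct)
  case (single a b)
  show ?case
    by (induction q rule: poly_mapping_add_induct)
      (simp_all add: mult_single toric_map_single toric_map_add \<phi>_add distrib_left)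
qed (simp add: toric_map_add distrib_right)

lemma toric_ideal_ideal: "ideal (toric_ideal s \<phi> :: 'k::field mpoly set) (poly_ring s)"
proof (rule poly_idealI)
  show "0 \<in> toric_ideal s \<phi>" by (simp add: toric_ideal_def psum_def)
  show "p + q \<in> toric_ideal s \<phi>" if "p \<in> toric_ideal s \<phi>" "q \<in> toric_ideal s \<phi>" for p q :: "'k mpoly"
    using that Poly_Mapping.keys_add[of p q] by (auto simp: toric_ideal_def toric_map_add)
  show "q * p \<in> toric_ideal s \<phi>" if "p \<in> toric_ideal s \<phi>" "q \<in> carrier (poly_ring s)" for p q :: "'k mpoly"
    using that carrier_mult[of q s p] by (simp add: toric_ideal_def toric_map_mult)
qed (auto simp: toric_ideal_def)

text \<open>Laurent polynomials have no zero divisors, and the homomorphism maps 1 to 1, so its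
  kernel is a proper prime ideal.\<close>

lemma toric_ideal_prime: "primeideal (toric_ideal s \<phi> :: 'k::field mpoly set) (poly_ring s)"
proof (rule primeidealI[OF toric_ideal_ideal cring_poly_ring])
  have "\<Phi> (1 :: 'k mpoly) = 1"
    using toric_map_single[of 0 1] by (simp add: exponent_map_zero)
  then have "1 \<notin> (toric_ideal s \<phi> :: 'k mpoly set)" by (simp add: toric_ideal_def)
  then show "carrier (poly_ring s) \<noteq> (toric_ideal s \<phi> :: 'k mpoly set)"
    by (auto simp: exponents_def)
qed (auto simp: toric_ideal_def toric_map_mult)

lemma binomial_in_toric_ideal:
  assumes "a \<in> exponents s" "b \<in> exponents s" "\<phi> a = \<phi> b"
  shows "monomial a - monomial b \<in> (toric_ideal s \<phi> :: 'k::field mpoly set)"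
proof -
  have "\<Phi> (monomial a + Poly_Mapping.single b (- 1)) = (0 :: (nat \<Rightarrow>\<^sub>0 int) \<Rightarrow>\<^sub>0 'k)"
    using assms(3) by (simp add: toric_map_add toric_map_single monomial_def flip: single_add)
  then have "\<Phi> (monomial a - monomial b) = (0 :: (nat \<Rightarrow>\<^sub>0 int) \<Rightarrow>\<^sub>0 'k)"
    by (simp add: monomial_def single_uminus)
  then show ?thesis
    using assms(1,2) Poly_Mapping.keys_diff[of "monomial a :: 'k mpoly" "monomial b"]
    by (auto simp: toric_ideal_def monomial_def)
qed

text \<open>Different images under \<open>\<phi>\<close> are exponents of different Laurent
  monomials, and these are linearly independent.\<close>

lemma indep_mod_toric_ideal:
  assumes "inj_on \<phi> F" "finite F"
  shows "indep_mod (toric_ideal s \<phi> :: 'k::field mpoly set) F monomial"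
  unfolding indep_mod_def
proof (intro allI impI ballI)
  fix c :: "(nat \<Rightarrow>\<^sub>0 nat) \<Rightarrow> 'k" and v
  assume *: "(\<Sum>u\<in>F. const (c u) * monomial u) \<in> toric_ideal s \<phi>" and v: "v \<in> F"
  have "0 = \<Phi> (\<Sum>u\<in>F. const (c u) * monomial u)"
    using * by (simp add: toric_ideal_def)
  also have "\<dots> = (\<Sum>u\<in>F. Poly_Mapping.single (\<phi> u) (c u))"
    by (simp add: toric_map_sum monomial_def mult_single toric_map_single)
  finally have "0 = Poly_Mapping.lookup (\<Sum>u\<in>F. Poly_Mapping.single (\<phi> u) (c u)) (\<phi> v)"
    by (metis lookup_zero)
  also have "\<dots> = (\<Sum>u\<in>F. if u = v then c u else 0)"
    unfolding lookup_sum using assms(1) v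
    by (intro sum.cong) (auto simp: lookup_single when_def inj_on_def)
  also have "\<dots> = c v" using v assms(2) by simp
  finally show "c v = 0" by simp
qed

text \<open>The toric ideal is one of the primes in the infimum. The monomials in the variables
  \<open>J\<close> are independent modulo it, so \<open>prime_chain_length\<close> bounds every
  chain that ends there.\<close>

lemma height_le_toric:
  fixes I :: "'k::field mpoly set"
  assumes I: "I \<subseteq> toric_ideal s \<phi>" and J: "J \<subseteq> {..<s}"
    and inj: "inj_on \<phi> {u. Poly_Mapping.keys u \<subseteq> J}"
  shows "height (poly_ring s) I \<le> enat (s - card J)"
proof -
  have "height (poly_ring s) I \<le> prime_height (poly_ring s) (toric_ideal s \<phi> :: 'k mpoly set)"
    unfolding height_def using I toric_ideal_prime by (intro INF_lower) auto
  also have "\<dots> \<le> enat (s - card J)"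
    unfolding prime_height_def
  proof (rule SUP_least)
    fix n
    assume "n \<in> {n. \<exists>C. (\<forall>i\<le>n. primeideal (C i) (poly_ring s)) \<and> (\<forall>i<n. C i \<subset> C (Suc i)) \<and>
      C n = (toric_ideal s \<phi> :: 'k mpoly set)}"
    then obtain C where C: "\<And>i. i \<le> n \<Longrightarrow> primeideal (C i) (poly_ring s)"
      "\<And>i. i < n \<Longrightarrow> C i \<subset> C (Suc i)" "C n = (toric_ideal s \<phi> :: 'k mpoly set)"
      by blast
    have "finite J" using J finite_subset by blast
    then have "indep_mod (C n) (box J N) monomial" for N
      unfolding C(3) using inj
      by (intro indep_mod_toric_ideal card_box) (auto intro: inj_on_subset simp: box_def)
    from prime_chain_length[OF C(1,2) J this] show "enat n \<le> enat (s - card J)" by simp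
  qed
  finally show ?thesis .
qed

end

section \<open>Lattices of exponent differences\<close>

definition ivec :: "(nat \<Rightarrow>\<^sub>0 nat) \<Rightarrow> (nat \<Rightarrow>\<^sub>0 int)" where
  "ivec u = Poly_Mapping.map int u"

lemma lookup_ivec [simp]: "Poly_Mapping.lookup (ivec u) i = int (Poly_Mapping.lookup u i)"
  by (simp add: ivec_def Poly_Mapping.map.rep_eq when_def)

lemma ivec_add: "ivec (u + v) = ivec u + ivec v"
  by (rule poly_mapping_eqI) (simp add: lookup_add)

lemma ivec_nmult: "ivec (nmult n u) = frag_cmul (int n) (ivec u)"
  by (rule poly_mapping_eqI) simp

lemma ivec_eq_iff: "ivec u = ivec v \<longleftrightarrow> u = v"
  by (auto simp: poly_mapping_eq_iff fun_eq_iff dest!: arg_cong[where f = Poly_Mapping.lookup])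

lemma ivec_pos_neg: "ivec (pos_part x) - ivec (neg_part x) = x"
  by (rule poly_mapping_eqI) (simp add: lookup_minus lookup_pos_part lookup_neg_part)

definition comb :: "nat \<Rightarrow> (nat \<Rightarrow> 'a \<Rightarrow>\<^sub>0 int) \<Rightarrow> (nat \<Rightarrow> int) \<Rightarrow> 'a \<Rightarrow>\<^sub>0 int" where
  "comb r c n = (\<Sum>i<r. frag_cmul (n i) (c i))"

lemma lookup_comb: "Poly_Mapping.lookup (comb r c n) j = (\<Sum>i<r. n i * Poly_Mapping.lookup (c i) j)"
  by (simp add: comb_def lookup_sum)

lemma comb_zero: "comb r c (\<lambda>_. 0) = 0"
  by (simp add: comb_def)

lemma comb_add: "comb r c (\<lambda>i. m i + n i) = comb r c m + comb r c n"
  by (simp add: comb_def frag_cmul_distrib sum.distrib)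

lemma comb_cmul: "comb r c (\<lambda>i. k * n i) = frag_cmul k (comb r c n)"
  by (rule poly_mapping_eqI) (simp add: lookup_comb sum_distrib_left mult.assoc)

lemma comb_uminus: "comb r c (\<lambda>i. - n i) = - comb r c n"
  using comb_cmul[of r c "- 1" n] by simp

lemma comb_delta: "i < r \<Longrightarrow> comb r c (\<lambda>j. if j = i then 1 else 0) = c i"
  by (rule poly_mapping_eqI) (simp add: lookup_comb if_distrib[of "\<lambda>x. x * _"] cong: if_cong)

context
  fixes s :: nat and \<Lambda> :: "(nat \<Rightarrow>\<^sub>0 int) set"
  assumes \<Lambda>: "subgroup \<Lambda> (free_Abelian_group {..<s})"
begin

lemma lattice_keys: "x \<in> \<Lambda> \<Longrightarrow> Poly_Mapping.keys x \<subseteq> {..<s}"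
  using subgroup.mem_carrier[OF \<Lambda>] by simp

lemma lattice_zero: "0 \<in> \<Lambda>"
  using subgroup.one_closed[OF \<Lambda>] by simp

lemma lattice_add: "x \<in> \<Lambda> \<Longrightarrow> y \<in> \<Lambda> \<Longrightarrow> x + y \<in> \<Lambda>"
  using subgroup.m_closed[OF \<Lambda>, of x y] by simp

lemma lattice_uminus: "x \<in> \<Lambda> \<Longrightarrow> - x \<in> \<Lambda>"
  using subgroup.m_inv_closed[OF \<Lambda>, of x] lattice_keys[of x] by simp

lemma lattice_diff: "x \<in> \<Lambda> \<Longrightarrow> y \<in> \<Lambda> \<Longrightarrow> x - y \<in> \<Lambda>"
  using lattice_add[of x "- y"] lattice_uminus by simp

lemma lattice_cmul: "x \<in> \<Lambda> \<Longrightarrow> frag_cmul n x \<in> \<Lambda>"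
  using group.subgroup_int_pow_closed[OF group_free_Abelian_group \<Lambda>, of x n] lattice_keys[of x]
  by simp

lemma lattice_sum: "(\<And>i. i \<in> A \<Longrightarrow> f i \<in> \<Lambda>) \<Longrightarrow> sum f A \<in> \<Lambda>"
  by (induction A rule: infinite_finite_induct) (simp_all add: lattice_zero lattice_add)

lemma lattice_comb: "(\<And>i. i < r \<Longrightarrow> c i \<in> \<Lambda>) \<Longrightarrow> comb r c n \<in> \<Lambda>"
  unfolding comb_def by (intro lattice_sum lattice_cmul) simp

lemma part_exponents:
  assumes "x \<in> \<Lambda>"
  shows "pos_part x \<in> exponents s" "neg_part x \<in> exponents s"
  using lattice_keys[OF assms]
  by (auto simp: exponents_def in_keys_iff lookup_pos_part lookup_neg_part subset_iff)

text \<open>A common shift drops out of \<open>ivec u - ivec v\<close>, which gives cancellation and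
  makes \<open>power_binomial_reduced\<close> available for lattices.\<close>

lemma lattice_cong: "cancel_monoid_cong (\<lambda>u v. ivec u - ivec v \<in> \<Lambda>)"
proof unfold_locales
  show "equivp (\<lambda>u v. ivec u - ivec v \<in> \<Lambda>)"
  proof (rule equivpI)
    show "reflp (\<lambda>u v. ivec u - ivec v \<in> \<Lambda>)"
      by (simp add: reflp_def lattice_zero)
    show "symp (\<lambda>u v. ivec u - ivec v \<in> \<Lambda>)"
    proof (rule sympI)
      show "ivec v - ivec u \<in> \<Lambda>" if "ivec u - ivec v \<in> \<Lambda>" for u v
        using lattice_uminus[OF that] by simp
    qed
    show "transp (\<lambda>u v. ivec u - ivec v \<in> \<Lambda>)"
    proof (rule transpI)
      show "ivec u - ivec w \<in> \<Lambda>" if "ivec u - ivec v \<in> \<Lambda>" "ivec v - ivec w \<in> \<Lambda>" for u v w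
        using lattice_add[OF that] by simp
    qed
  qed
qed (simp_all add: ivec_add)

text \<open>The set \<open>J\<close> is a maximal set of variables that are independent modulo \<open>\<Lambda>\<close>; every other
  variable has a relation to \<open>J\<close> in \<open>\<Lambda>\<close>, and \<open>\<phi>\<close> uses these relations to project along \<open>\<Lambda>\<close>
  onto \<open>\<int>\<^sup>J\<close>.\<close>

lemma height_lattice_ideal_less:
  assumes gen: "\<And>x. x \<in> \<Lambda> \<Longrightarrow> \<exists>n. x = comb r c n"
    and dep: "comb r c m = 0" "i0 < r" "m i0 \<noteq> 0"
  shows "height (poly_ring s) (lattice_ideal_of s \<Lambda> :: 'k::field mpoly set) < enat r"
proof -
  define \<J> where
    "\<J> = {J. J \<subseteq> {..<s} \<and> (\<forall>x\<in>\<Lambda>. Poly_Mapping.keys x \<subseteq> J \<longrightarrow> x = 0)}"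
  have "finite \<J>" unfolding \<J>_def by (rule finite_subset[of _ "Pow {..<s}"]) auto
  moreover have "{} \<in> \<J>" by (simp add: \<J>_def)
  ultimately obtain J where "J \<in> \<J>" and J_max: "\<And>J'. J' \<in> \<J> \<Longrightarrow> J \<subseteq> J' \<Longrightarrow> J = J'"
    using finite_has_maximal[of \<J>] by blast
  then have J: "J \<subseteq> {..<s}" "\<And>x. x \<in> \<Lambda> \<Longrightarrow> Poly_Mapping.keys x \<subseteq> J \<Longrightarrow> x = 0"
    by (simp_all add: \<J>_def)
  define K where "K = {..<s} - J"
  have finK: "finite K" by (simp add: K_def)
  have "\<exists>x. x \<in> \<Lambda> \<and> Poly_Mapping.keys x \<subseteq> insert k J \<and> Poly_Mapping.lookup x k \<noteq> 0"
    if "k \<in> K" for k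
  proof -
    have "insert k J \<notin> \<J>" using J_max[of "insert k J"] that by (auto simp: K_def)
    moreover have "insert k J \<subseteq> {..<s}" using J(1) that by (auto simp: K_def)
    ultimately obtain x where x: "x \<in> \<Lambda>" "Poly_Mapping.keys x \<subseteq> insert k J" "x \<noteq> 0"
      unfolding \<J>_def by blast
    have "Poly_Mapping.lookup x k \<noteq> 0"
    proof
      assume "Poly_Mapping.lookup x k = 0"
      with x(2) have "Poly_Mapping.keys x \<subseteq> J" by (auto simp: in_keys_iff)
      with J(2) x show False by blast
    qed
    with x show ?thesis by blast
  qed
  then obtain x where x: "\<And>k. k \<in> K \<Longrightarrow> x k \<in> \<Lambda>"
    "\<And>k. k \<in> K \<Longrightarrow> Poly_Mapping.keys (x k) \<subseteq> insert k J"
    "\<And>k. k \<in> K \<Longrightarrow> Poly_Mapping.lookup (x k) k \<noteq> 0" by metis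
  \<comment> \<open>Multiplying each relation by the diagonal entries of the others gives the
    \<open>y k\<close> a common diagonal entry: on the coordinates \<open>K\<close> they form
    \<open>D\<close> times the identity matrix.\<close>
  define D where "D = (\<Prod>k\<in>K. Poly_Mapping.lookup (x k) k)"
  define y where "y k = frag_cmul (\<Prod>j\<in>K - {k}. Poly_Mapping.lookup (x j) j) (x k)" for k
  have D: "D \<noteq> 0" unfolding D_def using x(3) finK by simp
  have y: "y k \<in> \<Lambda>" if "k \<in> K" for k
    unfolding y_def using x(1)[OF that] by (rule lattice_cmul)
  have y_diag: "Poly_Mapping.lookup (y k) k = D" if "k \<in> K" for k
    unfolding D_def y_def using that finK by (simp add: prod.remove[of K k] mult.commute)
  have y_off: "Poly_Mapping.lookup (y k) l = 0" if "k \<in> K" "l \<in> K" "l \<noteq> k" for k l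
  proof -
    have "l \<notin> Poly_Mapping.keys (x k)" using x(2)[OF that(1)] that by (auto simp: K_def)
    then show ?thesis by (simp add: y_def in_keys_iff)
  qed
  have y_sum: "(\<Sum>k\<in>K. z k * Poly_Mapping.lookup (y k) l) = z l * D" if "l \<in> K" for z l
    using finK that y_off by (subst sum.remove[of K l]) (auto simp: y_diag intro!: sum.neutral)
  \<comment> \<open>\<open>\<psi>\<close> clears the coordinates in \<open>K\<close>, so it maps
    \<open>\<Lambda>\<close> to lattice vectors supported in \<open>J\<close>, which are zero by the
    choice of \<open>J\<close>.\<close>
  define \<psi> where "\<psi> z = frag_cmul D z - (\<Sum>k\<in>K. frag_cmul (Poly_Mapping.lookup z k) (y k))" for z
  have \<psi>_add: "\<psi> (z + z') = \<psi> z + \<psi> z'" for z z'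
    by (simp add: \<psi>_def lookup_add frag_cmul_distrib frag_cmul_distrib2 sum.distrib)
  have \<psi>_lattice: "\<psi> z = 0" if z: "z \<in> \<Lambda>" for z
  proof -
    have "\<psi> z \<in> \<Lambda>"
      unfolding \<psi>_def by (intro lattice_diff lattice_sum lattice_cmul z y)
    moreover have "Poly_Mapping.lookup (\<psi> z) l = 0" if "l \<in> K" for l
      using y_sum[OF that] by (simp add: \<psi>_def lookup_minus lookup_sum mult.commute)
    ultimately show ?thesis
      using lattice_keys[of "\<psi> z"] by (intro J(2)) (auto simp: K_def in_keys_iff subset_iff)
  qed
  define \<phi> where "\<phi> u = \<psi> (ivec u)" for u
  have \<phi>_add: "\<phi> (u + v) = \<phi> u + \<phi> v" for u v
    by (simp add: \<phi>_def ivec_add \<psi>_add)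
  have \<phi>_J: "\<phi> u = frag_cmul D (ivec u)" if "Poly_Mapping.keys u \<subseteq> J" for u
  proof -
    have "Poly_Mapping.lookup u k = 0" if "k \<in> K" for k
      using that \<open>Poly_Mapping.keys u \<subseteq> J\<close> by (auto simp: K_def in_keys_iff subset_iff)
    then show ?thesis by (simp add: \<phi>_def \<psi>_def)
  qed
  have inj: "inj_on \<phi> {u. Poly_Mapping.keys u \<subseteq> J}"
  proof (rule inj_onI)
    fix u v assume uv: "u \<in> {u. Poly_Mapping.keys u \<subseteq> J}" "v \<in> {u. Poly_Mapping.keys u \<subseteq> J}" "\<phi> u = \<phi> v"
    then have eq: "frag_cmul D (ivec u) = frag_cmul D (ivec v)" using \<phi>_J by simp
    show "u = v"
    proof (rule poly_mapping_eqI)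
      fix i
      show "Poly_Mapping.lookup u i = Poly_Mapping.lookup v i"
        using arg_cong[OF eq, of "\<lambda>z. Poly_Mapping.lookup z i"] D by simp
    qed
  qed
  have "(lattice_ideal_of s \<Lambda> :: 'k mpoly set) \<subseteq> toric_ideal s \<phi>"
    unfolding lattice_ideal_of_def
  proof (rule genideal_subset[OF toric_ideal_ideal[OF \<phi>_add]], safe)
    fix z assume z: "z \<in> \<Lambda>"
    have "\<phi> (pos_part z) = \<psi> (z + ivec (neg_part z))"
      using ivec_pos_neg[of z] by (simp add: \<phi>_def algebra_simps)
    also have "\<dots> = \<phi> (neg_part z)"
      by (simp add: \<psi>_add \<psi>_lattice[OF z] \<phi>_def)
    finally show "monomial (pos_part z) - monomial (neg_part z) \<in> (toric_ideal s \<phi> :: 'k mpoly set)"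
      using part_exponents[OF z] by (intro binomial_in_toric_ideal \<phi>_add)
  qed
  then have "height (poly_ring s) (lattice_ideal_of s \<Lambda> :: 'k mpoly set) \<le> enat (s - card J)"
    using J(1) inj by (intro height_le_toric[of \<phi>] \<phi>_add) auto
  moreover have "card K = s - card J"
    unfolding K_def using J(1) by (subst card_Diff_subset) (auto intro: finite_subset)
  moreover have "card K < r"
  proof (rule ccontr)
    assume "\<not> ?thesis"
    \<comment> \<open>The index \<open>s\<close>, which is not in \<open>K\<close>, stands for the
      relation \<open>m\<close>: the coefficient vectors of the \<open>y k\<close> together with
      \<open>m\<close> are too many to be independent.\<close>
    then have "card {..<r} < card (insert s K)"
      using finK by (simp add: K_def)
    moreover obtain n where n: "\<And>k. k \<in> K \<Longrightarrow> y k = comb r c (n k)"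
      using gen[OF y] by metis
    ultimately obtain z where z: "\<exists>k\<in>insert s K. z k \<noteq> 0"
      "\<forall>e\<in>{..<r}. (\<Sum>k\<in>insert s K. (if k = s then - m e else n k e) * z k) = 0"
      using finite_system_nontrivial_solution[of "{..<r}" "insert s K" "\<lambda>e k. if k = s then - m e else n k e"]
        finK by auto
    have eq: "(\<Sum>k\<in>K. n k e * z k) = m e * z s" if "e < r" for e
    proof -
      have "s \<notin> K" by (simp add: K_def)
      then have "(\<Sum>k\<in>K. (if k = s then - m e else n k e) * z k) = (\<Sum>k\<in>K. n k e * z k)"
        by (intro sum.cong) auto
      with z(2) that \<open>s \<notin> K\<close> finK show ?thesis by simp
    qed
    \<comment> \<open>At coordinate \<open>l\<close> only \<open>y l\<close> contributes, with entry
      \<open>D\<close>, while \<open>m\<close> contributes nothing because it is a relation.\<close>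
    have z0: "z l = 0" if l: "l \<in> K" for l
    proof -
      have "z l * D = (\<Sum>k\<in>K. z k * Poly_Mapping.lookup (y k) l)"
        using y_sum[OF l] by simp
      also have "\<dots> = (\<Sum>k\<in>K. \<Sum>e<r. z k * (n k e * Poly_Mapping.lookup (c e) l))"
        by (intro sum.cong) (simp_all add: n lookup_comb sum_distrib_left)
      also have "\<dots> = (\<Sum>e<r. (\<Sum>k\<in>K. n k e * z k) * Poly_Mapping.lookup (c e) l)"
        by (subst sum.swap) (simp add: sum_distrib_left sum_distrib_right mult_ac)
      also have "\<dots> = (\<Sum>e<r. z s * (m e * Poly_Mapping.lookup (c e) l))"
        by (intro sum.cong) (simp_all add: eq)
      also have "\<dots> = z s * Poly_Mapping.lookup (comb r c m) l"
        by (simp add: lookup_comb sum_distrib_left)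
      finally show ?thesis using D dep(1) by simp
    qed
    with eq[OF dep(2)] dep(3) have "z s = 0" by simp
    with z0 z(1) show False by auto
  qed
  ultimately show ?thesis
    by (metis enat_ord_simps(2) order_le_less_trans)
qed

end

section \<open>Connecting exponent vectors by moves\<close>

definition meets :: "(nat \<Rightarrow>\<^sub>0 nat) \<Rightarrow> nat set \<Rightarrow> bool" where
  "meets u Z \<longleftrightarrow> Poly_Mapping.keys u \<inter> Z \<noteq> {}"

lemma meets_iff: "meets u Z \<longleftrightarrow> (\<exists>j\<in>Z. Poly_Mapping.lookup u j \<noteq> 0)"
  by (auto simp: meets_def in_keys_iff)

lemma meets_add: "meets (u + v) Z \<longleftrightarrow> meets u Z \<or> meets v Z"
  by (auto simp: meets_iff lookup_add)

text \<open>Applied to the rows, \<open>power_binomial_reduced\<close> for this congruence shows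
  that \<open>\<Lambda>\<close> is contained in their span.\<close>

lemma span_cong: "cancel_monoid_cong (\<lambda>u v. \<exists>n. ivec u - ivec v = comb r c n)"
proof unfold_locales
  show "equivp (\<lambda>u v. \<exists>n. ivec u - ivec v = comb r c n)"
  proof (rule equivpI)
    show "reflp (\<lambda>u v. \<exists>n. ivec u - ivec v = comb r c n)"
      using comb_zero[of r c] by (auto simp: reflp_def intro!: exI[of _ "\<lambda>_. 0"])
    show "symp (\<lambda>u v. \<exists>n. ivec u - ivec v = comb r c n)"
      by (rule sympI) (metis comb_uminus minus_diff_eq)
    show "transp (\<lambda>u v. \<exists>n. ivec u - ivec v = comb r c n)"
    proof (rule transpI, elim exE)
      fix u v w m n assume "ivec u - ivec v = comb r c m" "ivec v - ivec w = comb r c n"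
      then have "ivec u - ivec w = comb r c (\<lambda>i. m i + n i)"
        by (simp add: comb_add algebra_simps)
      then show "\<exists>n. ivec u - ivec w = comb r c n" by blast
    qed
  qed
qed (simp_all add: ivec_add)

text \<open>This congruence contains every row that meets \<open>Z\<close> on both sides or on neither; \<open>M\<close> stands for
  the former.\<close>

lemma avoiding_cong:
  "monoid_cong (\<lambda>u v. (meets u Z \<longleftrightarrow> meets v Z) \<and>
     (\<not> meets u Z \<longrightarrow> (\<exists>q. ivec u - ivec v = comb r c q \<and> (\<forall>i\<in>M. q i = 0))))"
  (is "monoid_cong (\<lambda>u v. ?m u v \<and> (\<not> meets u Z \<longrightarrow> ?P u v))")
proof unfold_locales
  have refl: "?P u u" for u
    using comb_zero[of r c] by (auto intro!: exI[of _ "\<lambda>_. 0"])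
  have sym: "?P v u" if "?P u v" for u v
  proof -
    from that obtain q where "ivec u - ivec v = comb r c q" "\<forall>i\<in>M. q i = 0" by blast
    then show ?thesis
      by (intro exI[of _ "\<lambda>i. - q i"]) (simp add: comb_uminus flip: minus_diff_eq[of "ivec u"])
  qed
  have trans: "?P u w" if "?P u v" "?P v w" for u v w
  proof -
    from that obtain p q where "ivec u - ivec v = comb r c p" "\<forall>i\<in>M. p i = 0"
      "ivec v - ivec w = comb r c q" "\<forall>i\<in>M. q i = 0" by blast
    then show ?thesis
      by (intro exI[of _ "\<lambda>i. p i + q i"]) (simp add: comb_add algebra_simps)
  qed
  show "equivp (\<lambda>u v. ?m u v \<and> (\<not> meets u Z \<longrightarrow> ?P u v))"
  proof (rule equivpI)
    show "reflp (\<lambda>u v. ?m u v \<and> (\<not> meets u Z \<longrightarrow> ?P u v))"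
      using refl by (intro reflpI) blast
    show "symp (\<lambda>u v. ?m u v \<and> (\<not> meets u Z \<longrightarrow> ?P u v))"
      using sym by (intro sympI) blast
    show "transp (\<lambda>u v. ?m u v \<and> (\<not> meets u Z \<longrightarrow> ?P u v))"
    proof (rule transpI)
      fix u v w
      assume "?m u v \<and> (\<not> meets u Z \<longrightarrow> ?P u v)" "?m v w \<and> (\<not> meets v Z \<longrightarrow> ?P v w)"
      then show "?m u w \<and> (\<not> meets u Z \<longrightarrow> ?P u w)" using trans[of u v w] by argo
    qed
  qed
qed (simp add: meets_add ivec_add)

locale binomial_system =
  fixes s r :: nat and a b :: "nat \<Rightarrow> nat \<Rightarrow>\<^sub>0 nat"
  assumes exps: "\<And>i. i < r \<Longrightarrow> a i \<in> exponents s" "\<And>i. i < r \<Longrightarrow> b i \<in> exponents s"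
begin

abbreviation span :: "(nat \<Rightarrow> int) \<Rightarrow> nat \<Rightarrow>\<^sub>0 int" where
  "span \<equiv> comb r (\<lambda>i. ivec (a i) - ivec (b i))"

text \<open>The set \<open>Z\<close> stands for the coordinate subspace \<open>t\<^sub>Z = 0\<close>, on which exactly the rows that meet
  \<open>Z\<close> vanish; the bound says that this piece of the zero set is not too large.\<close>

lemma closed_set_bound:
  assumes indep: "\<And>m i. span m = 0 \<Longrightarrow> i < r \<Longrightarrow> m i = 0"
    and nilp: "\<And>E n. monoid_cong E \<Longrightarrow> (\<And>i. i < r \<Longrightarrow> E (a i) (b i)) \<Longrightarrow>
      \<exists>N. \<exists>k\<in>{1..N}. E (nmult k (pos_part (span n)) + nmult (N - k) (neg_part (span n)))
        (nmult N (neg_part (span n)))"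
    and Z: "finite Z" "Z \<noteq> {}" and closed: "\<And>i. i < r \<Longrightarrow> meets (a i) Z \<longleftrightarrow> meets (b i) Z"
  shows "card {i\<in>{..<r}. meets (a i) Z} < card Z"
proof (rule ccontr)
  define M where "M = {i\<in>{..<r}. meets (a i) Z}"
  assume "\<not> card {i\<in>{..<r}. meets (a i) Z} < card Z"
  then have "card Z \<le> card M" by (simp add: M_def)
  have finM: "finite M" and M: "M \<subseteq> {..<r}" by (auto simp: M_def)
  obtain z where z: "z \<in> Z" using Z(2) by blast
  let ?c = "\<lambda>i j. Poly_Mapping.lookup (ivec (a i) - ivec (b i)) j"
  \<comment> \<open>One coordinate \<open>z\<close> is left out, so there are fewer equations than
    rows; the sign \<open>\<sigma>\<close> then makes the combination nonnegative at
    \<open>z\<close> as well.\<close>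
  have "card (Z - {z}) < card M"
    using \<open>card Z \<le> card M\<close> z Z(1) by (metis card_Diff1_less order_less_le_trans)
  then obtain x where x: "\<exists>i\<in>M. x i \<noteq> 0" "\<forall>j\<in>Z - {z}. (\<Sum>i\<in>M. ?c i j * x i) = 0"
    using finite_system_nontrivial_solution[of "Z - {z}" M "\<lambda>j i. ?c i j"] finM Z(1) by auto
  define \<sigma> where "\<sigma> = (if (\<Sum>i\<in>M. ?c i z * x i) \<ge> 0 then 1 else - 1 :: int)"
  define n where "n i = (if i \<in> M then \<sigma> * x i else 0)" for i
  have lookup_n: "Poly_Mapping.lookup (span n) j = \<sigma> * (\<Sum>i\<in>M. ?c i j * x i)" for j
  proof -
    have "Poly_Mapping.lookup (span n) j = (\<Sum>i\<in>M. n i * ?c i j)"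
      unfolding lookup_comb using M by (intro sum.mono_neutral_right) (auto simp: n_def)
    also have "\<dots> = \<sigma> * (\<Sum>i\<in>M. ?c i j * x i)"
      unfolding sum_distrib_left by (intro sum.cong) (simp_all add: n_def algebra_simps)
    finally show ?thesis .
  qed
  have nonneg: "Poly_Mapping.lookup (span n) j \<ge> 0" if "j \<in> Z" for j
    using x(2) that unfolding lookup_n by (cases "j = z") (auto simp: \<sigma>_def)
  define E where "E u v \<longleftrightarrow> (meets u Z \<longleftrightarrow> meets v Z) \<and>
    (\<not> meets u Z \<longrightarrow> (\<exists>q. ivec u - ivec v = span q \<and> (\<forall>i\<in>M. q i = 0)))" for u v
  have "monoid_cong E" unfolding E_def by (rule avoiding_cong)
  moreover have "E (a i) (b i)" if i: "i < r" for i
  proof -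
    have "ivec (a i) - ivec (b i) = span (\<lambda>j. if j = i then 1 else 0)"
      using comb_delta[OF i, of "\<lambda>i. ivec (a i) - ivec (b i)"] by simp
    moreover have "\<forall>j\<in>M. (if j = i then 1 else 0 :: int) = 0" if "\<not> meets (a i) Z"
      using that by (auto simp: M_def)
    ultimately show ?thesis unfolding E_def using closed[OF i] by blast
  qed
  ultimately obtain N k where k: "k \<in> {1..N}"
    and E: "E (nmult k (pos_part (span n)) + nmult (N - k) (neg_part (span n)))
        (nmult N (neg_part (span n)))"
    using nilp[of E n] by blast
  \<comment> \<open>Since \<open>span n\<close> is nonnegative on \<open>Z\<close>, its negative
    part avoids \<open>Z\<close>, and \<open>E\<close> provides a combination without the rows in
    \<open>M\<close>.\<close>
  have "\<not> meets (nmult N (neg_part (span n))) Z"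
    using nonneg by (auto simp: meets_iff lookup_neg_part)
  with E obtain q where q: "\<forall>i\<in>M. q i = 0"
    "ivec (nmult k (pos_part (span n)) + nmult (N - k) (neg_part (span n))) -
      ivec (nmult N (neg_part (span n))) = span q"
    unfolding E_def by blast
  note q(2)[symmetric]
  also have "ivec (nmult k (pos_part (span n)) + nmult (N - k) (neg_part (span n))) -
      ivec (nmult N (neg_part (span n))) =
      frag_cmul (int k) (ivec (pos_part (span n)) - ivec (neg_part (span n)))"
    using k by (intro poly_mapping_eqI)
      (auto simp: ivec_add ivec_nmult lookup_minus lookup_add of_nat_diff algebra_simps)
  also have "\<dots> = span (\<lambda>i. int k * n i)"
    by (simp add: ivec_pos_neg comb_cmul)
  finally have "span (\<lambda>i. int k * n i + - q i) = 0"
    by (simp only: comb_add comb_uminus) simp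
  from indep[OF this] have "int k * n i + - q i = 0" if "i \<in> M" for i
    using that M by blast
  with q(1) k have "n i = 0" if "i \<in> M" for i using that by fastforce
  moreover have "\<sigma> \<noteq> 0" by (simp add: \<sigma>_def)
  ultimately show False using x(1) by (auto simp: n_def)
qed

text \<open>If some row meets \<open>Z\<close> on one side only, adding a coordinate of its other side to \<open>Z\<close> puts this
  row into \<open>M\<close>, so both cardinalities grow.\<close>

lemma mixed_rows_bound:
  assumes closed_bound: "\<And>Z. finite Z \<Longrightarrow> Z \<noteq> {} \<Longrightarrow> (\<And>i. i < r \<Longrightarrow> meets (a i) Z \<longleftrightarrow> meets (b i) Z) \<Longrightarrow>
      card {i\<in>{..<r}. meets (a i) Z} < card Z"
    and U: "\<And>i. i < r \<Longrightarrow> Poly_Mapping.keys (a i) \<subseteq> U \<longleftrightarrow> Poly_Mapping.keys (b i) \<subseteq> U"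
    and Z: "Z \<subseteq> {..<s} - U" "Z \<noteq> {}" and M: "M \<subseteq> {..<r}"
    and mixed: "\<And>i. i \<in> M \<Longrightarrow> meets (a i) Z \<and> meets (b i) Z"
  shows "card M < card Z"
  using Z M mixed
proof (induction "s - card Z" arbitrary: Z M rule: less_induct)
  case less
  have finZ: "finite Z" using less.prems(1) finite_subset by blast
  have finM: "finite M" using less.prems(3) finite_subset by blast
  show ?case
  proof (cases "\<forall>i<r. meets (a i) Z \<longleftrightarrow> meets (b i) Z")
    case True
    then have "card {i\<in>{..<r}. meets (a i) Z} < card Z"
      using finZ less.prems(2) by (intro closed_bound) auto
    moreover have "card M \<le> card {i\<in>{..<r}. meets (a i) Z}"
      using less.prems(3,4) by (intro card_mono) auto
    ultimately show ?thesis by simp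
  next
    case False
    then obtain i where i: "i < r" "meets (a i) Z \<noteq> meets (b i) Z" by blast
    have "meets (a i) Z \<or> meets (b i) Z" using i(2) by blast
    then have "\<not> Poly_Mapping.keys (a i) \<subseteq> U \<or> \<not> Poly_Mapping.keys (b i) \<subseteq> U"
      using less.prems(1) by (auto simp: meets_def)
    then have "\<not> Poly_Mapping.keys (a i) \<subseteq> U" "\<not> Poly_Mapping.keys (b i) \<subseteq> U"
      using U[OF i(1)] by auto
    \<comment> \<open>\<open>z\<close> is taken on the side of row \<open>i\<close> that misses
      \<open>Z\<close>; neither side is contained in \<open>U\<close>.\<close>
    then obtain z where z: "z \<notin> U" "z \<notin> Z" "z < s"
      "meets (a i) (insert z Z)" "meets (b i) (insert z Z)"
      using i exps[OF i(1)] unfolding meets_def exponents_def by blast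
    have "i \<notin> M" using less.prems(4) i(2) by blast
    have "card (insert z Z) \<le> card {..<s}"
      using less.prems(1) z(3) by (intro card_mono) auto
    then have "s - card (insert z Z) < s - card Z"
      using finZ z(2) by simp
    then have "card (insert i M) < card (insert z Z)"
    proof (rule less.hyps)
      fix j assume "j \<in> insert i M"
      then show "meets (a j) (insert z Z) \<and> meets (b j) (insert z Z)"
        using z(4,5) less.prems(4)[of j] by (auto simp: meets_def)
    qed (use less.prems z i in auto)
    then show ?thesis using finZ finM z(2) \<open>i \<notin> M\<close> by simp
  qed
qed

text \<open>If no row with a move left can be applied at \<open>x\<close>, then every such row \<open>i\<close> has a coordinate
  \<open>f i\<close> at which \<open>x\<close> is too small, and since \<open>y \<ge> 0\<close> some row \<open>g i\<close> has to refill that coordinate.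
  On a cycle of \<open>g\<close> the rows are as many as the coordinates \<open>f i\<close> at least, and they meet them on
  both sides.\<close>

lemma applicable_row:
  assumes bound: "\<And>Z M. Z \<subseteq> {..<s} - U \<Longrightarrow> Z \<noteq> {} \<Longrightarrow> M \<subseteq> {..<r} \<Longrightarrow>
      (\<And>i. i \<in> M \<Longrightarrow> meets (a i) Z \<and> meets (b i) Z) \<Longrightarrow> card M < card Z"
    and xy: "ivec x - ivec y = span (\<lambda>i. int (n i))" and n: "i0 < r" "n i0 \<noteq> 0"
  shows "\<exists>i<r. n i \<noteq> 0 \<and> (\<forall>j. j \<notin> U \<longrightarrow> Poly_Mapping.lookup (a i) j \<le> Poly_Mapping.lookup x j)"
proof (rule ccontr)
  assume none: "\<not> ?thesis"
  define R where "R = {i\<in>{..<r}. n i \<noteq> 0}"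
  have finR: "finite R" and R: "R \<subseteq> {..<r}" and "R \<noteq> {}" using n by (auto simp: R_def)
  have "\<exists>j. j \<notin> U \<and> Poly_Mapping.lookup x j < Poly_Mapping.lookup (a i) j" if "i \<in> R" for i
    using none that by (auto simp: R_def not_le)
  then obtain f where f: "\<And>i. i \<in> R \<Longrightarrow> f i \<notin> U"
    "\<And>i. i \<in> R \<Longrightarrow> Poly_Mapping.lookup x (f i) < Poly_Mapping.lookup (a i) (f i)" by metis
  have "\<exists>i'\<in>R. Poly_Mapping.lookup (b i') (f i) \<noteq> 0" if i: "i \<in> R" for i
  proof (rule ccontr)
    assume "\<not> ?thesis"
    then have b0: "Poly_Mapping.lookup (b i') (f i) = 0" if "i' \<in> R" for i' using that by blast
    \<comment> \<open>Without a row that refills \<open>f i\<close>, the moves would remove at least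
      the entry of \<open>a i\<close> there, which is more than \<open>x\<close> has.\<close>
    have "int (Poly_Mapping.lookup (a i) (f i)) \<le> int (n i) * int (Poly_Mapping.lookup (a i) (f i))"
      using i mult_right_mono[of 1 "int (n i)" "int (Poly_Mapping.lookup (a i) (f i))"]
      by (simp add: R_def)
    also have "\<dots> \<le> (\<Sum>j\<in>R. int (n j) * int (Poly_Mapping.lookup (a j) (f i)))"
      using i finR by (intro member_le_sum) auto
    also have "\<dots> = (\<Sum>j<r. int (n j) * Poly_Mapping.lookup (ivec (a j) - ivec (b j)) (f i))"
      using b0 by (intro sum.mono_neutral_cong_left) (auto simp: R_def lookup_minus)
    also have "\<dots> = Poly_Mapping.lookup (ivec x - ivec y) (f i)"
      by (simp add: xy lookup_comb)
    also have "\<dots> \<le> int (Poly_Mapping.lookup x (f i))"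
      by (simp add: lookup_minus)
    finally show False using f(2)[OF i] by simp
  qed
  then obtain g where g: "\<And>i. i \<in> R \<Longrightarrow> g i \<in> R"
    "\<And>i. i \<in> R \<Longrightarrow> Poly_Mapping.lookup (b (g i)) (f i) \<noteq> 0" by metis
  \<comment> \<open>A minimal nonempty set closed under \<open>g\<close> is mapped onto itself by
    \<open>g\<close>; it plays the role of the cycle.\<close>
  define \<R> where "\<R> = {M. M \<subseteq> R \<and> M \<noteq> {} \<and> g ` M \<subseteq> M}"
  have "finite \<R>" unfolding \<R>_def by (rule finite_subset[of _ "Pow R"]) (auto simp: finR)
  moreover have "R \<in> \<R>" using g(1) \<open>R \<noteq> {}\<close> by (auto simp: \<R>_def)
  ultimately obtain M where "M \<in> \<R>" and M_min: "\<And>M'. M' \<in> \<R> \<Longrightarrow> M' \<subseteq> M \<Longrightarrow> M = M'"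
    using finite_has_minimal[of \<R>] by blast
  then have M: "M \<subseteq> R" "M \<noteq> {}" "g ` M \<subseteq> M" by (simp_all add: \<R>_def)
  have "g ` M \<in> \<R>" using M by (auto simp: \<R>_def)
  from M_min[OF this M(3)] have gM: "g ` M = M" by simp
  have "card M < card (f ` M)"
  proof (rule bound)
    have "f i < s" if "i \<in> R" for i
    proof -
      have "f i \<in> Poly_Mapping.keys (a i)" using f(2)[OF that] by (auto simp: in_keys_iff)
      then show ?thesis using exps(1)[of i] R that by (auto simp: exponents_def)
    qed
    then show "f ` M \<subseteq> {..<s} - U" using M(1) f(1) by blast
    fix i assume i: "i \<in> M"
    then obtain i' where i': "i' \<in> M" "i = g i'" using gM by blast
    have "Poly_Mapping.lookup (a i) (f i) \<noteq> 0" using f(2)[of i] i M(1) by fastforce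
    moreover have "Poly_Mapping.lookup (b i) (f i') \<noteq> 0" using g(2)[of i'] i' M(1) by blast
    ultimately show "meets (a i) (f ` M) \<and> meets (b i) (f ` M)"
      using i i'(1) by (auto simp: meets_iff)
  qed (use M R in auto)
  moreover have "card (f ` M) \<le> card M"
    using M(1) finR finite_subset by (blast intro: card_image_le)
  ultimately show False by simp
qed

end

section \<open>Invertible variables modulo a congruence\<close>

lemma exponents_diff:
  assumes "x \<in> exponents s"
  shows "x - p \<in> exponents s"
proof -
  have "Poly_Mapping.keys (x - p) \<subseteq> Poly_Mapping.keys x"
    by (auto simp: in_keys_iff lookup_minus)
  then show ?thesis using assms by (auto simp: exponents_def)
qed

lemma exponents_split:
  assumes "x \<in> exponents s" "\<And>j. Poly_Mapping.lookup p j \<le> Poly_Mapping.lookup x j"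
  shows "\<exists>w\<in>exponents s. x = p + w"
proof
  show "x = p + (x - p)"
    using assms(2) by (intro poly_mapping_eqI) (simp add: lookup_add lookup_minus)
  show "x - p \<in> exponents s"
    using assms(1) by (rule exponents_diff)
qed

text \<open>Shifts are restricted to \<open>exponents s\<close> because an ideal of
  \<open>poly_ring s\<close> is only closed under multiplication by polynomials in the first
  \<open>s\<close> variables.\<close>

locale exponent_cong =
  fixes s :: nat and E :: "(nat \<Rightarrow>\<^sub>0 nat) \<Rightarrow> (nat \<Rightarrow>\<^sub>0 nat) \<Rightarrow> bool"
  assumes refl: "E u u" and sym: "E u v \<Longrightarrow> E v u" and trans: "E u v \<Longrightarrow> E v w \<Longrightarrow> E u w"
    and cong_add: "E u v \<Longrightarrow> w \<in> exponents s \<Longrightarrow> E (u + w) (v + w)"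
begin

definition units :: "nat set" where
  "units = {v. v < s \<and> (\<exists>w\<in>exponents s. E (Poly_Mapping.single v 1 + w) 0)}"

lemma sum_equiv_zero:
  assumes "\<And>i. i \<in> A \<Longrightarrow> f i \<in> exponents s \<and> E (f i) 0"
  shows "sum f A \<in> exponents s \<and> E (sum f A) 0"
  using assms
proof (induction A rule: infinite_finite_induct)
  case (insert x F)
  then have "E (f x + sum f F) (0 + sum f F)" by (intro cong_add) auto
  then show ?case using insert exponents_add[of "f x" s "sum f F"] trans by auto
qed (auto simp: refl exponents_def)

lemma nmult_equiv_zero:
  assumes "e \<in> exponents s" "E e 0"
  shows "nmult k e \<in> exponents s" "E (nmult k e) 0"
  using sum_equiv_zero[of "{..<k}" "\<lambda>_. e"] assms by (simp_all add: nmult_def del: sum_constant)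

text \<open>Multiplying, over all invertible variables, the variable with its inverse monomial gives
  a monomial equivalent to 1 in which each of them occurs.\<close>

lemma ex_full_unit:
  "\<exists>e\<in>exponents s. E e 0 \<and> (\<forall>j\<in>units. Poly_Mapping.lookup e j \<noteq> 0)"
proof -
  have "\<exists>w\<in>exponents s. E (Poly_Mapping.single v 1 + w) 0" if "v \<in> units" for v
    using that by (simp add: units_def)
  then obtain w where w: "\<And>v. v \<in> units \<Longrightarrow> w v \<in> exponents s"
    "\<And>v. v \<in> units \<Longrightarrow> E (Poly_Mapping.single v 1 + w v) 0"
    by metis
  define e where "e = (\<Sum>v\<in>units. Poly_Mapping.single v 1 + w v)"
  have fin: "finite units" unfolding units_def by (rule finite_subset[of _ "{..<s}"]) auto
  have "e \<in> exponents s \<and> E e 0"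
    unfolding e_def
  proof (rule sum_equiv_zero)
    fix v assume v: "v \<in> units"
    then have "Poly_Mapping.single v 1 \<in> exponents s" by (simp add: units_def exponents_def)
    then show "Poly_Mapping.single v 1 + w v \<in> exponents s \<and> E (Poly_Mapping.single v 1 + w v) 0"
      using w[OF v] exponents_add by blast
  qed
  moreover have "Poly_Mapping.lookup e j \<noteq> 0" if j: "j \<in> units" for j
  proof -
    have "Poly_Mapping.lookup (Poly_Mapping.single j 1 + w j) j \<le> Poly_Mapping.lookup e j"
      unfolding e_def lookup_sum using fin j
      by (intro member_le_sum[of j units "\<lambda>v. Poly_Mapping.lookup (Poly_Mapping.single v 1 + w v) j"]) auto
    then show ?thesis by (simp add: lookup_add)
  qed
  ultimately show ?thesis by blast
qed

lemma nmult_dominates: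
  assumes "\<And>j. j \<in> units \<Longrightarrow> Poly_Mapping.lookup e j \<noteq> 0"
  shows "\<exists>k. \<forall>j\<in>units. Poly_Mapping.lookup u j \<le> Poly_Mapping.lookup (nmult k e) j"
proof (intro exI ballI)
  let ?k = "\<Sum>j\<in>Poly_Mapping.keys u. Poly_Mapping.lookup u j"
  fix j assume j: "j \<in> units"
  have "Poly_Mapping.lookup u j \<le> ?k"
    by (cases "j \<in> Poly_Mapping.keys u") (auto intro: member_le_sum simp: in_keys_iff)
  also have "?k * 1 \<le> ?k * Poly_Mapping.lookup e j"
    using assms[OF j] by (intro mult_le_mono2) simp
  finally show "Poly_Mapping.lookup u j \<le> Poly_Mapping.lookup (nmult ?k e) j" by simp
qed

text \<open>A monomial in invertible variables divides a power of the full unit, so it is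
  invertible. Then so is any equivalent monomial, and with it each of its variables.\<close>

lemma units_closed:
  assumes "u \<in> exponents s" "E u v" "Poly_Mapping.keys v \<subseteq> units"
  shows "Poly_Mapping.keys u \<subseteq> units"
proof
  fix j assume j: "j \<in> Poly_Mapping.keys u"
  obtain e where e: "e \<in> exponents s" "E e 0" "\<And>j. j \<in> units \<Longrightarrow> Poly_Mapping.lookup e j \<noteq> 0"
    using ex_full_unit by blast
  obtain k where k: "\<And>j. j \<in> units \<Longrightarrow> Poly_Mapping.lookup v j \<le> Poly_Mapping.lookup (nmult k e) j"
    using nmult_dominates[of e v] e(3) by blast
  have "Poly_Mapping.lookup v j \<le> Poly_Mapping.lookup (nmult k e) j" for j
  proof (cases "j \<in> units")
    case False
    then have "j \<notin> Poly_Mapping.keys v" using assms(3) by blast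
    then show ?thesis by (simp add: in_keys_iff)
  qed (rule k)
  from exponents_split[OF nmult_equiv_zero(1)[OF e(1,2)] this]
  obtain w where w: "w \<in> exponents s" "nmult k e = v + w" by blast
  have "E (u + w) (v + w)" by (rule cong_add[OF assms(2) w(1)])
  also have "v + w = nmult k e" by (simp add: w(2))
  finally have "E (u + w) 0" using nmult_equiv_zero(2)[OF e(1,2)] trans by blast
  have "Poly_Mapping.lookup (Poly_Mapping.single j 1) i \<le> Poly_Mapping.lookup u i" for i
    using j by (auto simp: lookup_single when_def in_keys_iff)
  from exponents_split[OF assms(1) this]
  obtain w' where w': "w' \<in> exponents s" "u = Poly_Mapping.single j 1 + w'" by blast
  have "E (Poly_Mapping.single j 1 + (w' + w)) 0"
    using \<open>E (u + w) 0\<close> w'(2) by (simp add: add.assoc)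
  moreover have "w' + w \<in> exponents s" using w w' exponents_add by blast
  moreover have "j < s" using assms(1) j by (auto simp: exponents_def)
  ultimately show "j \<in> units" unfolding units_def by blast
qed

end

section \<open>Performing the moves inside the congruence\<close>

locale binomial_system_cong = binomial_system + exponent_cong +
  assumes row: "i < r \<Longrightarrow> E (a i) (b i)"
begin

text \<open>Adding a multiple of the unit \<open>e\<close> to both vectors makes all coordinates in \<^term>\<open>units\<close>
  large, so that only the other coordinates can prevent a move.\<close>

lemma connected_of_nonneg_combination:
  assumes bound: "\<And>Z M. Z \<subseteq> {..<s} - units \<Longrightarrow> Z \<noteq> {} \<Longrightarrow> M \<subseteq> {..<r} \<Longrightarrow>
      (\<And>i. i \<in> M \<Longrightarrow> meets (a i) Z \<and> meets (b i) Z) \<Longrightarrow> card M < card Z"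
    and "x \<in> exponents s" "y \<in> exponents s" "ivec x - ivec y = span (\<lambda>i. int (n i))"
  shows "E x y"
  using assms(2-)
proof (induction "\<Sum>i<r. n i" arbitrary: n x y)
  case 0
  then have "span (\<lambda>i. int (n i)) = 0" by (simp add: comb_def)
  with 0 have "x = y" by (simp add: ivec_eq_iff)
  then show ?case by (simp add: refl)
next
  case (Suc N)
  have "\<exists>i<r. n i \<noteq> 0"
  proof (rule ccontr)
    assume "\<not> ?thesis"
    then have "(\<Sum>i<r. n i) = 0" by simp
    with Suc.hyps(2) show False by simp
  qed
  then obtain i where i: "i < r" "n i \<noteq> 0"
    "\<And>j. j \<notin> units \<Longrightarrow> Poly_Mapping.lookup (a i) j \<le> Poly_Mapping.lookup x j"
    using applicable_row[OF bound Suc.prems(3)] by blast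
  obtain e where e: "e \<in> exponents s" "E e 0" "\<And>j. j \<in> units \<Longrightarrow> Poly_Mapping.lookup e j \<noteq> 0"
    using ex_full_unit by blast
  obtain k where k: "\<And>j. j \<in> units \<Longrightarrow> Poly_Mapping.lookup (a i) j \<le> Poly_Mapping.lookup (nmult k e) j"
    using nmult_dominates[of e "a i"] e(3) by blast
  define d where "d = nmult k e"
  have d: "d \<in> exponents s" "E d 0" using nmult_equiv_zero[OF e(1,2)] by (simp_all add: d_def)
  have shift: "E (u + d) u" if "u \<in> exponents s" for u
    using cong_add[OF d(2) that] by (simp add: add.commute)
  have "Poly_Mapping.lookup (a i) j \<le> Poly_Mapping.lookup (x + d) j" for j
    using i(3)[of j] k[of j] by (cases "j \<in> units") (simp_all add: d_def lookup_add trans_le_add2 trans_le_add1 del: lookup_nmult)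
  from exponents_split[OF exponents_add[OF Suc.prems(1) d(1)] this]
  obtain w where w: "w \<in> exponents s" "x + d = a i + w" by blast
  define n' where "n' = n(i := n i - 1)"
  have n_n': "int (n j) = int (n' j) + (if j = i then 1 else 0)" for j
    using i(2) by (auto simp: n'_def of_nat_diff)
  have "(\<Sum>j<r. n j) = Suc (\<Sum>j<r. n' j)"
    using i(1,2) sum.remove[of "{..<r}" i n] sum.remove[of "{..<r}" i n'] by (simp add: n'_def)
  with Suc.hyps(2) have "N = (\<Sum>j<r. n' j)" by simp
  moreover have "ivec (b i + w) - ivec (y + d) = span (\<lambda>j. int (n' j))"
  proof -
    have span_n: "span (\<lambda>j. int (n j)) = span (\<lambda>j. int (n' j)) + (ivec (a i) - ivec (b i))"
      unfolding n_n' comb_add using comb_delta[OF i(1), of "\<lambda>i. ivec (a i) - ivec (b i)"] by simp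
    have "ivec x = ivec (a i) + ivec w - ivec d"
      using arg_cong[OF w(2), of ivec] by (simp add: ivec_add algebra_simps)
    then have "ivec (b i + w) - ivec (y + d) = (ivec x - ivec y) - (ivec (a i) - ivec (b i))"
      by (simp add: ivec_add)
    with Suc.prems(3) span_n show ?thesis by simp
  qed
  ultimately have "E (b i + w) (y + d)"
    using Suc.prems(2) w(1) d(1) exps(2)[OF i(1)] by (intro Suc.hyps(1)) (auto intro: exponents_add)
  moreover have "E (x + d) (b i + w)"
    unfolding w(2) by (rule cong_add[OF row[OF i(1)] w(1)])
  ultimately show ?case
    using shift[OF Suc.prems(1)] shift[OF Suc.prems(2)] sym trans by blast
qed

text \<open>Rows with a negative coefficient are reversed. The congruence is symmetric and the
  condition in the bound treats both sides alike, so all hypotheses survive.\<close>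

lemma connected_of_combination:
  assumes bound: "\<And>Z M. Z \<subseteq> {..<s} - units \<Longrightarrow> Z \<noteq> {} \<Longrightarrow> M \<subseteq> {..<r} \<Longrightarrow>
      (\<And>i. i \<in> M \<Longrightarrow> meets (a i) Z \<and> meets (b i) Z) \<Longrightarrow> card M < card Z"
    and "x \<in> exponents s" "y \<in> exponents s" and xy: "ivec x - ivec y = span n"
  shows "E x y"
proof -
  define a' where "a' i = (if n i \<ge> 0 then a i else b i)" for i
  define b' where "b' i = (if n i \<ge> 0 then b i else a i)" for i
  interpret oriented: binomial_system_cong s r a' b' E
    by unfold_locales (auto simp: a'_def b'_def exps row intro: sym)
  have "oriented.span (\<lambda>i. int (nat \<bar>n i\<bar>)) = span n"
    by (rule poly_mapping_eqI)
      (auto simp: lookup_comb a'_def b'_def lookup_minus algebra_simps intro!: sum.cong)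
  with xy have "ivec x - ivec y = oriented.span (\<lambda>i. int (nat \<bar>n i\<bar>))" by simp
  show ?thesis
  proof (rule oriented.connected_of_nonneg_combination[OF bound assms(2,3)])
    show "ivec x - ivec y = oriented.span (\<lambda>i. int (nat \<bar>n i\<bar>))" by fact
    show "meets (a i) Z \<and> meets (b i) Z"
      if "\<And>i. i \<in> M \<Longrightarrow> meets (a' i) Z \<and> meets (b' i) Z" "i \<in> M" for i Z and M :: "nat set"
      using that(1)[OF that(2)] by (auto simp: a'_def b'_def split: if_splits)
  qed
qed

end

text \<open>The polynomials vanishing on the classes of a monoid congruence form an ideal, so it
  suffices to check the generators.\<close>

lemma class_vanishing_genideal:
  fixes p :: "'k::field mpoly"
  assumes "monoid_cong E" "S \<subseteq> carrier (poly_ring s)"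
    "\<And>p. p \<in> S \<Longrightarrow> class_vanishing E p" "p \<in> Idl\<^bsub>poly_ring s\<^esub> S"
  shows "class_vanishing E p"
proof -
  have "ideal {p \<in> carrier (poly_ring s). class_vanishing E (p :: 'k mpoly)} (poly_ring s)"
  proof (rule poly_idealI)
    fix p q :: "'k mpoly"
    assume "p \<in> {p \<in> carrier (poly_ring s). class_vanishing E p}"
      "q \<in> {p \<in> carrier (poly_ring s). class_vanishing E p}"
    then show "p + q \<in> {p \<in> carrier (poly_ring s). class_vanishing E p}"
      using Poly_Mapping.keys_add[of p q] by (auto intro: class_vanishing_add)
  next
    fix p q :: "'k mpoly"
    assume "p \<in> {p \<in> carrier (poly_ring s). class_vanishing E p}" "q \<in> carrier (poly_ring s)"
    then show "q * p \<in> {p \<in> carrier (poly_ring s). class_vanishing E p}"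
      using monoid_cong.class_vanishing_mult[OF assms(1)] carrier_mult[of q s p] by auto
  qed (auto simp: class_vanishing_zero)
  from genideal_subset[OF this, of S] show ?thesis using assms(2-4) by blast
qed

lemma binomial_carrier:
  "u \<in> exponents s \<Longrightarrow> v \<in> exponents s \<Longrightarrow>
    monomial u - monomial v \<in> carrier (poly_ring s :: 'k::field mpoly ring)"
  using Poly_Mapping.keys_diff[of "monomial u :: 'k mpoly" "monomial v"]
  by (auto simp: monomial_def)

lemma exponent_cong_ideal:
  fixes I :: "'k::field mpoly set"
  assumes I: "ideal I (poly_ring s)"
  shows "exponent_cong s (\<lambda>u v. monomial u - monomial v \<in> I)"
proof
  show "monomial u - monomial u \<in> I" for u
    using poly_ideal_zero[OF I] by simp
  show "monomial v - monomial u \<in> I" if "monomial u - monomial v \<in> I" for u v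
    using poly_ideal_uminus[OF I that] by simp
  show "monomial u - monomial w \<in> I"
    if "monomial u - monomial v \<in> I" "monomial v - monomial w \<in> I" for u v w
    using poly_ideal_add[OF I that] by simp
  show "monomial (u + w) - monomial (v + w) \<in> I"
    if "monomial u - monomial v \<in> I" "w \<in> exponents s" for u v w
    using poly_ideal_mult[OF I that(1) monomial_carrier[OF that(2)]]
    by (simp add: monomial_add right_diff_distrib mult.commute)
qed

section \<open>Lattice ideals generated up to radical\<close>

theorem theorem2p20:
  fixes L :: "'k::field_char_0 mpoly set"
    and g :: "nat \<Rightarrow> 'k mpoly"
    and s r :: nat
  assumes "is_lattice_ideal s L"
    and "height (poly_ring s) L = enat r"
    and "\<And>i. i < r \<Longrightarrow> is_binomial s (g i)"
    and "radical (poly_ring s) L = radical (poly_ring s) (Idl\<^bsub>poly_ring s\<^esub> (g ` {..<r}))"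
  shows "L = Idl\<^bsub>poly_ring s\<^esub> (g ` {..<r})"
proof -
  interpret R: cring "poly_ring s :: 'k mpoly ring" by (rule cring_poly_ring)
  define I where "I = Idl\<^bsub>poly_ring s\<^esub> (g ` {..<r})"
  obtain \<Lambda> where \<Lambda>: "subgroup \<Lambda> (free_Abelian_group {..<s})" and L: "L = lattice_ideal_of s \<Lambda>"
    using assms(1) unfolding is_lattice_ideal_def by blast
  obtain a b where ab: "\<And>i. i < r \<Longrightarrow> a i \<in> exponents s" "\<And>i. i < r \<Longrightarrow> b i \<in> exponents s"
    "\<And>i. i < r \<Longrightarrow> g i = monomial (a i) - monomial (b i)"
    using assms(3) unfolding is_binomial_def by metis
  interpret binomial_system s r a b by unfold_locales (fact ab)+
  define B where "B x = (monomial (pos_part x) - monomial (neg_part x) :: 'k mpoly)" for x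
  have L_gen: "L = Idl\<^bsub>poly_ring s\<^esub> (B ` \<Lambda>)"
    unfolding L lattice_ideal_of_def B_def by (simp add: setcompr_eq_image)
  have B_carrier: "B ` \<Lambda> \<subseteq> carrier (poly_ring s)"
    unfolding B_def using part_exponents[OF \<Lambda>] binomial_carrier by blast
  have g_carrier: "g ` {..<r} \<subseteq> carrier (poly_ring s)"
  proof (rule image_subsetI)
    fix i assume "i \<in> {..<r}"
    then show "g i \<in> carrier (poly_ring s)"
      by (simp add: ab binomial_carrier del: poly_ring_simps)
  qed
  have L_ideal: "ideal L (poly_ring s)"
    unfolding L_gen by (rule R.genideal_ideal[OF B_carrier])
  have I_ideal: "ideal I (poly_ring s)"
    unfolding I_def by (rule R.genideal_ideal[OF g_carrier])
  have g_I: "g i \<in> I" if "i < r" for i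
    unfolding I_def using R.genideal_self[OF g_carrier] that by blast
  have B_L: "B x \<in> L" if "x \<in> \<Lambda>" for x
    unfolding L_gen using R.genideal_self[OF B_carrier] that by blast
  have row_lattice: "ivec (a i) - ivec (b i) \<in> \<Lambda>" if i: "i < r" for i
  proof -
    interpret lat: cancel_monoid_cong "\<lambda>u v. ivec u - ivec v \<in> \<Lambda>" by (rule lattice_cong[OF \<Lambda>])
    have "g i \<in> radical (poly_ring s) L"
      using radical_superset[OF I_ideal] g_I[OF i] assms(4) by (auto simp: I_def)
    then obtain n where "g i ^ n \<in> L" unfolding radical_def by auto
    then have "class_vanishing (\<lambda>u v. ivec u - ivec v \<in> \<Lambda>) (g i ^ n)"
      unfolding L_gen
    proof (rule class_vanishing_genideal[OF lat.monoid_cong_axioms B_carrier, rotated])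
      show "class_vanishing (\<lambda>u v. ivec u - ivec v \<in> \<Lambda>) p" if "p \<in> B ` \<Lambda>" for p
        using that by (auto simp: B_def lat.class_vanishing_binomial ivec_pos_neg)
    qed
    then show ?thesis
      unfolding ab(3)[OF i] by (rule lat.power_binomial_reduced)
  qed
  \<comment> \<open>This is used for two congruences: the one given by the span of the rows, and the
    one that tracks which vectors meet \<open>Z\<close>.\<close>
  have nilpotent: "\<exists>N. class_vanishing E (B x ^ N)"
    if "x \<in> \<Lambda>" "monoid_cong E" "\<And>i. i < r \<Longrightarrow> E (a i) (b i)" for x E
  proof -
    interpret E: monoid_cong E by fact
    have "B x \<in> radical (poly_ring s) I"
      using radical_superset[OF L_ideal] B_L[OF that(1)] assms(4) by (auto simp: I_def)
    then obtain N where "B x ^ N \<in> I" unfolding radical_def by auto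
    then have "class_vanishing E (B x ^ N)"
      unfolding I_def
    proof (rule class_vanishing_genideal[OF that(2) g_carrier, rotated])
      show "class_vanishing E p" if "p \<in> g ` {..<r}" for p
        using that ab(3) \<open>\<And>i. i < r \<Longrightarrow> E (a i) (b i)\<close> by (auto simp: E.class_vanishing_binomial)
    qed
    then show ?thesis by blast
  qed
  have lattice_span: "\<exists>n. x = span n" if x: "x \<in> \<Lambda>" for x
  proof -
    interpret sp: cancel_monoid_cong "\<lambda>u v. \<exists>n. ivec u - ivec v = span n" by (rule span_cong)
    have "\<exists>n. ivec (a i) - ivec (b i) = span n" if "i < r" for i
      using comb_delta[OF that, of "\<lambda>i. ivec (a i) - ivec (b i)"] by metis
    then obtain N where "class_vanishing (\<lambda>u v. \<exists>n. ivec u - ivec v = span n) (B x ^ N)"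
      using nilpotent[OF x sp.monoid_cong_axioms] by blast
    then have "\<exists>n. ivec (pos_part x) - ivec (neg_part x) = span n"
      unfolding B_def by (rule sp.power_binomial_reduced)
    then show ?thesis by (simp add: ivec_pos_neg)
  qed
  \<comment> \<open>A nontrivial relation among the rows would push the height of \<open>L\<close>
    below \<open>r\<close>.\<close>
  have indep: "m i = 0" if "span m = 0" "i < r" for m i
    using height_lattice_ideal_less[OF \<Lambda> lattice_span that, where 'k = 'k] assms(2) L by fastforce
  have closed_bound: "card {i\<in>{..<r}. meets (a i) Z} < card Z"
    if "finite Z" "Z \<noteq> {}" "\<And>i. i < r \<Longrightarrow> meets (a i) Z \<longleftrightarrow> meets (b i) Z" for Z
  proof (rule closed_set_bound)
    show "m i = 0" if "span m = 0" "i < r" for m i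
      using that by (rule indep)
  next
    fix E n
    assume E: "monoid_cong E" "\<And>i. i < r \<Longrightarrow> E (a i) (b i)"
    have "span n \<in> \<Lambda>" using row_lattice by (rule lattice_comb[OF \<Lambda>])
    from nilpotent[OF this E] obtain N where "class_vanishing E (B (span n) ^ N)" by blast
    from monoid_cong.power_binomial_class[OF E(1) this[unfolded B_def]]
    show "\<exists>N. \<exists>k\<in>{1..N}. E (nmult k (pos_part (span n)) + nmult (N - k) (neg_part (span n)))
        (nmult N (neg_part (span n)))" by blast
  qed (use that in auto)
  interpret I: exponent_cong s "\<lambda>u v. monomial u - monomial v \<in> I"
    by (rule exponent_cong_ideal[OF I_ideal])
  interpret binomial_system_cong s r a b "\<lambda>u v. monomial u - monomial v \<in> I"
    by unfold_locales (use g_I ab(3) in auto)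
  have units_row: "Poly_Mapping.keys (a i) \<subseteq> I.units \<longleftrightarrow> Poly_Mapping.keys (b i) \<subseteq> I.units"
    if "i < r" for i
    using I.units_closed[OF ab(1) row] I.units_closed[OF ab(2) I.sym[OF row]] that by blast
  have "B x \<in> I" if x: "x \<in> \<Lambda>" for x
  proof -
    obtain n where n: "ivec (pos_part x) - ivec (neg_part x) = span n"
      using lattice_span[OF x] by (auto simp: ivec_pos_neg)
    show ?thesis
      unfolding B_def
    proof (rule connected_of_combination[OF _ part_exponents[OF \<Lambda> x] n])
      fix Z M
      assume ZM: "Z \<subseteq> {..<s} - I.units" "Z \<noteq> {}" "M \<subseteq> {..<r}"
        "\<And>i. i \<in> M \<Longrightarrow> meets (a i) Z \<and> meets (b i) Z"
      show "card M < card Z"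
      proof (rule mixed_rows_bound[where U = I.units])
        show "card {i\<in>{..<r}. meets (a i) Z} < card Z"
          if "finite Z" "Z \<noteq> {}" "\<And>i. i < r \<Longrightarrow> meets (a i) Z \<longleftrightarrow> meets (b i) Z" for Z
          using that by (rule closed_bound)
      qed (use units_row ZM in auto)
    qed
  qed
  then have "L \<subseteq> I"
    unfolding L_gen using genideal_subset[OF I_ideal, of "B ` \<Lambda>"] by blast
  moreover have "I \<subseteq> L"
    unfolding I_def
  proof (rule genideal_subset[OF L_ideal], safe)
    fix i assume i: "i < r"
    define x where "x = ivec (a i) - ivec (b i)"
    have lx: "Poly_Mapping.lookup x j = int (Poly_Mapping.lookup (a i) j) - int (Poly_Mapping.lookup (b i) j)" for j
      by (simp add: x_def lookup_minus)
    \<comment> \<open>\<open>w\<close> is the common part of \<open>a i\<close> and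
      \<open>b i\<close>, so \<open>g i\<close> is \<open>monomial w\<close> times the lattice
      binomial of its row.\<close>
    define w where "w = a i - pos_part x"
    have w: "a i = pos_part x + w" "b i = neg_part x + w"
      by (intro poly_mapping_eqI; simp add: w_def lookup_add lookup_minus lookup_pos_part lookup_neg_part lx)+
    have "w \<in> exponents s"
      unfolding w_def using ab(1)[OF i] by (rule exponents_diff)
    from poly_ideal_mult[OF L_ideal B_L[OF row_lattice[OF i]] monomial_carrier[OF this]]
    have "monomial w * B x \<in> L" by (simp add: x_def)
    also have "monomial w * B x = g i"
      by (simp add: ab(3)[OF i] B_def w monomial_add algebra_simps)
    finally show "g i \<in> L" .
  qed
  ultimately show ?thesis by (simp add: I_def)
qed

end
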